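(* Let $\lambda\in(0,1]$, $n\in\{2,3,4,\cdots\}$ and let $T\in\mathbb{B}(\mathcal{H})$ be an $n$-power quasinormal operator. If $T^n$ is quasinormal, then the following are equivalent: (i) $T$ is quasinormal. (ii) $\|Tx\|^2\le\|T^2x\|\|x\|+\|(\Delta_{\lambda}(T))^n-\Delta_{\lambda}(T^n)\|\|x\|^2$ for all $x\in\mathcal{H}$. (iii) $|T|^2\le|T^2|+\|(\Delta_{\lambda}(T))^n-\Delta_{\lambda}(T^n)\|I$.
   Context: $\mathbb{B}(\mathcal{H})$ is the algebra of bounded linear operators on a complex Hilbert space $\mathcal{H}$. Write $[S,T]=ST-TS$. $T$ is quasinormal if $[T,T^*T]=0$ and $n$-power quasinormal if $[T^n,T^*T]=0$. $|T|=(T^*T)^{1/2}$, and $A\le B$ means $\langle (B-A)x,x\rangle\ge 0$ for all $x\in\mathcal{H}$. For an operator $T$ with polar decomposition $T=U|T|$ ($U$ the partial isometry with $\ker U=\ker |T|$) and $\lambda\in[0,1]$, the $\lambda$-Aluthge transform of $T$ is $\Delta_{\lambda}(T)=|T|^{\lambda}U|T|^{1-\lambda}$, where $|T|^0=I$; in particular $\Delta_1(T)=|T|U$. *)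

theory Defs
  imports "HOL-Analysis.Analysis" "HOL-Computational_Algebra.Polynomial"
begin

section \<open>Complex Hilbert spaces\<close>

text \<open>The underlying real inner product of a complex inner product space is the real part of
  the complex one, so norm and topology are those of \<^class>\<open>real_inner\<close>.  Positivity and
  definiteness of \<open>cinner\<close> follow from \<open>cinner_commute\<close> and \<open>inner_eq_Re_cinner\<close>.  The complex
  inner product is linear in its first argument.\<close>

class complex_inner = real_inner +
  fixes scaleC :: "complex \<Rightarrow> 'a \<Rightarrow> 'a"  (infixr "*\<^sub>C" 75)
    and cinner :: "'a \<Rightarrow> 'a \<Rightarrow> complex"
  assumes scaleC_add_right: "a *\<^sub>C (x + y) = a *\<^sub>C x + a *\<^sub>C y"
    and scaleC_add_left: "(a + b) *\<^sub>C x = a *\<^sub>C x + b *\<^sub>C x"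
    and scaleC_scaleC: "a *\<^sub>C b *\<^sub>C x = (a * b) *\<^sub>C x"
    and scaleC_of_real: "of_real r *\<^sub>C x = r *\<^sub>R x"
    and cinner_commute: "cinner x y = cnj (cinner y x)"
    and cinner_add_left: "cinner (x + y) z = cinner x z + cinner y z"
    and cinner_scaleC_left: "cinner (a *\<^sub>C x) y = a * cinner x y"
    and inner_eq_Re_cinner: "inner x y = Re (cinner x y)"

class chilbert_space = complex_inner + complete_space

instantiation complex :: chilbert_space
begin

definition scaleC_complex :: "complex \<Rightarrow> complex \<Rightarrow> complex"
  where "scaleC_complex a x = a * x"

definition cinner_complex :: "complex \<Rightarrow> complex \<Rightarrow> complex"
  where "cinner_complex x y = x * cnj y"

instance
  by standard
    (auto simp: scaleC_complex_def cinner_complex_def algebra_simps scaleR_conv_of_real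
      inner_complex_def)

end

section \<open>Bounded linear operators\<close>

text \<open>The elements of \<open>\<bbbB>(H)\<close> are the complex-linear elements of the type of bounded real-linear
  operators; the operator norm is that of \<^type>\<open>blinfun\<close>.\<close>

definition clinear_op :: "('a::complex_inner \<Rightarrow>\<^sub>L 'a) \<Rightarrow> bool"
  where "clinear_op T \<longleftrightarrow> (\<forall>c x. T (c *\<^sub>C x) = c *\<^sub>C T x)"

primrec op_power :: "('a::real_normed_vector \<Rightarrow>\<^sub>L 'a) \<Rightarrow> nat \<Rightarrow> ('a \<Rightarrow>\<^sub>L 'a)"
  where
    "op_power T 0 = id_blinfun"
  | "op_power T (Suc n) = T o\<^sub>L op_power T n"

definition commutator :: "('a::real_normed_vector \<Rightarrow>\<^sub>L 'a) \<Rightarrow> ('a \<Rightarrow>\<^sub>L 'a) \<Rightarrow> ('a \<Rightarrow>\<^sub>L 'a)"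
  where "commutator S T = (S o\<^sub>L T) - (T o\<^sub>L S)"

definition adj :: "('a::chilbert_space \<Rightarrow>\<^sub>L 'a) \<Rightarrow> ('a \<Rightarrow>\<^sub>L 'a)"
  where "adj T = (THE S. clinear_op S \<and> (\<forall>x y. cinner (T x) y = cinner x (S y)))"

definition op_le :: "('a::complex_inner \<Rightarrow>\<^sub>L 'a) \<Rightarrow> ('a \<Rightarrow>\<^sub>L 'a) \<Rightarrow> bool"
  where "op_le A B \<longleftrightarrow> (\<forall>x. cinner ((B - A) x) x \<in> \<real>\<^sub>\<ge>\<^sub>0)"

definition quasinormal :: "('a::chilbert_space \<Rightarrow>\<^sub>L 'a) \<Rightarrow> bool"
  where "quasinormal T \<longleftrightarrow> commutator T (adj T o\<^sub>L T) = 0"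

definition power_quasinormal :: "nat \<Rightarrow> ('a::chilbert_space \<Rightarrow>\<^sub>L 'a) \<Rightarrow> bool"
  where "power_quasinormal n T \<longleftrightarrow> commutator (op_power T n) (adj T o\<^sub>L T) = 0"

section \<open>Real powers of positive operators\<close>

text \<open>Only the real points of the spectrum are recorded; for self-adjoint operators this is the
  whole spectrum.  A two-sided inverse of a complex-linear operator is complex-linear.\<close>

definition real_spectrum :: "('a::complex_inner \<Rightarrow>\<^sub>L 'a) \<Rightarrow> real set"
  where "real_spectrum A = {t. \<not> (\<exists>S. S o\<^sub>L (A - t *\<^sub>R id_blinfun) = id_blinfun
    \<and> (A - t *\<^sub>R id_blinfun) o\<^sub>L S = id_blinfun)}"

definition poly_op :: "real poly \<Rightarrow> ('a::real_normed_vector \<Rightarrow>\<^sub>L 'a) \<Rightarrow> ('a \<Rightarrow>\<^sub>L 'a)"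
  where "poly_op p A = (\<Sum>i\<le>degree p. coeff p i *\<^sub>R op_power A i)"

text \<open>Continuous functional calculus \<open>f(A)\<close> for self-adjoint \<open>A\<close> and \<open>f\<close> continuous on the
  spectrum: the common limit of \<open>p\<^sub>k(A)\<close> over all sequences of polynomials \<open>p\<^sub>k\<close> converging to \<open>f\<close>
  uniformly on the spectrum of \<open>A\<close>.\<close>

definition cont_fun_calc :: "(real \<Rightarrow> real) \<Rightarrow> ('a::chilbert_space \<Rightarrow>\<^sub>L 'a) \<Rightarrow> ('a \<Rightarrow>\<^sub>L 'a)"
  where "cont_fun_calc f A = (THE B. \<forall>p :: nat \<Rightarrow> real poly.
    uniform_limit (real_spectrum A) (\<lambda>k t. poly (p k) t) f sequentially
      \<longrightarrow> (\<lambda>k. poly_op (p k) A) \<longlonglongrightarrow> B)"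

text \<open>The exponent \<open>0\<close> is treated separately because of the convention \<open>A\<^sup>0 = I\<close>, whereas
  \<open>0 powr 0 = 0\<close>.\<close>

definition op_powr :: "('a::chilbert_space \<Rightarrow>\<^sub>L 'a) \<Rightarrow> real \<Rightarrow> ('a \<Rightarrow>\<^sub>L 'a)"
  where "op_powr A r = (if r = 0 then id_blinfun else cont_fun_calc (\<lambda>t. t powr r) A)"

definition op_abs :: "('a::chilbert_space \<Rightarrow>\<^sub>L 'a) \<Rightarrow> ('a \<Rightarrow>\<^sub>L 'a)"
  where "op_abs T = op_powr (adj T o\<^sub>L T) (1 / 2)"

section \<open>Polar decomposition and Aluthge transforms\<close>

text \<open>A partial isometry is isometric on the orthogonal complement of its kernel.\<close>

definition partial_isometry :: "('a::complex_inner \<Rightarrow>\<^sub>L 'a) \<Rightarrow> bool"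
  where "partial_isometry U \<longleftrightarrow> clinear_op U \<and>
    (\<forall>x. (\<forall>y. U y = 0 \<longrightarrow> cinner x y = 0) \<longrightarrow> norm (U x) = norm x)"

definition polar_isometry :: "('a::chilbert_space \<Rightarrow>\<^sub>L 'a) \<Rightarrow> ('a \<Rightarrow>\<^sub>L 'a)"
  where "polar_isometry T = (THE U. partial_isometry U \<and> T = U o\<^sub>L op_abs T
    \<and> {x. U x = 0} = {x. op_abs T x = 0})"

definition aluthge :: "real \<Rightarrow> ('a::chilbert_space \<Rightarrow>\<^sub>L 'a) \<Rightarrow> ('a \<Rightarrow>\<^sub>L 'a)"
  where "aluthge l T =
    op_powr (op_abs T) l o\<^sub>L polar_isometry T o\<^sub>L op_powr (op_abs T) (1 - l)"

end

theory Submission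
  imports Defs "HOL-Computational_Algebra.Fundamental_Theorem_Algebra"
begin

text \<open>Write \<open>A = T\<^sup>*T\<close>, \<open>S = T\<^sup>n\<close> and \<open>Q = S\<^sup>*S\<close>.

  The number \<open>\<parallel>\<Delta>\<^sub>l(T)\<^sup>n - \<Delta>\<^sub>l(T\<^sup>n)\<parallel>\<close> is zero.  Indeed \<open>\<Delta>\<^sub>l(T) |T|\<^sup>l = |T|\<^sup>l T\<close>, so \<open>\<Delta>\<^sub>l(T)\<^sup>n\<close> and \<open>T\<^sup>n\<close>
  agree on the range of \<open>|T|\<^sup>l\<close> as soon as \<open>T\<^sup>n\<close> commutes with \<open>A\<close>, and both vanish on its kernel.  This
  gives \<open>\<Delta>\<^sub>l(T)\<^sup>n = T\<^sup>n\<close> (\<open>aluthge_power\<close>), and \<open>\<Delta>\<^sub>l(S) = S\<close> for the quasinormal operator \<open>S\<close>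
  (\<open>aluthge_quasinormal\<close>).  What remains is that \<open>T\<close> is quasinormal iff it is paranormal,
  \<open>\<parallel>Tx\<parallel>\<^sup>2 \<le> \<parallel>T\<^sup>2x\<parallel> \<parallel>x\<parallel>\<close>, and iff \<open>|T|\<^sup>2 \<le> |T\<^sup>2|\<close>.

  For quasinormal \<open>T\<close> one has \<open>|T\<^sup>2| = |T|\<^sup>2\<close> (\<open>quasinormal_imp_op_abs_square\<close>), and \<open>|T|\<^sup>2 \<le> |T\<^sup>2|\<close>
  implies paranormality by the Cauchy--Schwarz inequality (\<open>class_A_imp_paranormal\<close>).

  The substance is that a paranormal \<open>T\<close> is quasinormal (\<open>paranormal_imp_quasinormal\<close>).  Since \<open>S\<close>
  commutes with \<open>A\<close> and \<open>Q\<close>, a computation of \<open>\<parallel>TQx - QTx\<parallel>\<^sup>2\<close> shows that \<open>T\<close> commutes with \<open>Q\<close>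
  (\<open>commute_adj_compose_root\<close>), hence with \<open>B = Q\<^sup>1\<^sup>/\<^sup>n\<close>, and it suffices to prove \<open>A = B\<close>.
  Paranormality makes \<open>j \<mapsto> \<parallel>T\<^sup>jx\<parallel>\<close> log-convex; comparing the indices \<open>0, 1, n\<close> and \<open>1, n, 2n\<close>
  gives, for unit vectors,
  \<open>\<langle>Ax, x\<rangle>\<^sup>n \<le> \<langle>Qx, x\<rangle>\<close> and \<open>\<langle>Qx, x\<rangle>\<^sup>2\<^sup>n\<^sup>-\<^sup>1 \<le> \<langle>Ax, x\<rangle>\<^sup>n \<langle>Q\<^sup>2x, x\<rangle>\<^sup>n\<^sup>-\<^sup>1\<close>.
  On a joint approximate eigenvector of the commuting operators \<open>A\<close> and \<open>B\<close> with eigenvalues \<open>a\<close> and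
  \<open>s\<close> these say \<open>a \<le> s\<close> and \<open>s \<le> a\<close>.  Spectral projections are avoided: if \<open>A - B\<close> is nonzero, then
  the range of \<open>(A - B - e)\<^sup>+\<close> or of \<open>(B - A - e)\<^sup>+\<close> is nonzero for some \<open>e > 0\<close>, and \<open>B\<close> has
  approximate eigenvectors in it (\<open>joint_approximate_eigenvector\<close>).

  The rest is background: orthogonal projections and adjoints, the continuous functional calculus
  of self-adjoint operators, and the polar decomposition.  Except for complex linearity it takes
  place in the underlying real Hilbert space.\<close>

section \<open>Hilbert space preliminaries\<close>

text \<open>By the parallelogram law a minimizing sequence for the distance from \<open>x\<close> to \<open>M\<close> is a Cauchy
  sequence; its limit is the orthogonal projection of \<open>x\<close>.\<close>

lemma orthogonal_decomposition:
  fixes M :: "'a::{real_inner,complete_space} set"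
  assumes sub: "subspace M" and cl: "closed M"
  obtains p where "p \<in> M" "\<And>y. y \<in> M \<Longrightarrow> inner (x - p) y = 0"
proof -
  define d where "d = Inf ((\<lambda>y. (norm (x - y))\<^sup>2) ` M)"
  have ne: "M \<noteq> {}" using sub subspace_0 by blast
  have bdd: "bdd_below ((\<lambda>y. (norm (x - y))\<^sup>2) ` M)"
    by (rule bdd_belowI[of _ 0]) auto
  have d_le: "d \<le> (norm (x - y))\<^sup>2" if "y \<in> M" for y
    unfolding d_def by (rule cInf_lower[OF imageI[OF that] bdd])
  have ex: "\<exists>y\<in>M. (norm (x - y))\<^sup>2 < d + e" if "e > 0" for e :: real
    using cInf_lessD[of "(\<lambda>y. (norm (x - y))\<^sup>2) ` M" "d + e"] ne that
    unfolding d_def[symmetric] by auto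
  have "\<exists>y. \<forall>k::nat. y k \<in> M \<and> (norm (x - y k))\<^sup>2 < d + 1 / Suc k"
    by (rule choice) (use ex in \<open>metis zero_less_divide_1_iff of_nat_0_less_iff zero_less_Suc\<close>)
  then obtain y where yM: "\<And>k::nat. y k \<in> M" and yd: "\<And>k. (norm (x - y k))\<^sup>2 < d + 1 / Suc k"
    by blast
  have par: "(norm (u - v))\<^sup>2 \<le> 2 * (norm (x - u))\<^sup>2 + 2 * (norm (x - v))\<^sup>2 - 4 * d"
    if "u \<in> M" "v \<in> M" for u v
  proof -
    have "(1/2) *\<^sub>R (u + v) \<in> M" using that sub by (simp add: subspace_add subspace_scale)
    from d_le[OF this] show ?thesis
      by (simp add: power2_norm_eq_inner inner_simps inner_commute field_simps)
  qed
  have "Cauchy y"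
  proof (rule CauchyI)
    fix e :: real assume "e > 0"
    then obtain N :: nat where N: "inverse (Suc N) < e\<^sup>2 / 4"
      using reals_Archimedean[of "e\<^sup>2 / 4"] by (auto simp: power2_eq_square)
    have "norm (y m - y k) < e" if "m \<ge> N" "k \<ge> N" for m k
    proof -
      have *: "(norm (x - y j))\<^sup>2 < d + e\<^sup>2 / 4" if "j \<ge> N" for j
      proof -
        have "1 / real (Suc j) \<le> inverse (Suc N)"
          using that by (simp add: field_simps)
        then show ?thesis using yd[of j] N by linarith
      qed
      have "(norm (y m - y k))\<^sup>2 < e\<^sup>2"
        using par[OF yM yM, of m k] *[OF that(1)] *[OF that(2)] by linarith
      then show ?thesis using \<open>e > 0\<close> by (simp add: power2_less_imp_less)
    qed
    then show "\<exists>N. \<forall>m\<ge>N. \<forall>k\<ge>N. norm (y m - y k) < e" by blast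
  qed
  then obtain p where lim: "y \<longlonglongrightarrow> p" using Cauchy_convergent convergentD by blast
  have pM: "p \<in> M" using closed_sequentially[OF cl] yM lim by blast
  have l1: "(\<lambda>k. (norm (x - y k))\<^sup>2) \<longlonglongrightarrow> (norm (x - p))\<^sup>2"
    by (intro tendsto_intros lim)
  have l2: "(\<lambda>k. d + 1 / real (Suc k)) \<longlonglongrightarrow> d + 0"
    by (rule tendsto_add[OF tendsto_const LIMSEQ_Suc[OF lim_1_over_n]])
  have pd: "(norm (x - p))\<^sup>2 \<le> d"
    using LIMSEQ_le[OF l1 l2] yd less_imp_le by auto
  have "inner (x - p) u = 0" if "u \<in> M" for u
  proof (rule ccontr)
    assume c: "inner (x - p) u \<noteq> 0"
    then have u: "inner u u > 0" by auto
    define c where "c = inner (x - p) u / inner u u"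
    have "p + c *\<^sub>R u \<in> M" using pM that sub by (simp add: subspace_add subspace_scale)
    then have "(norm (x - p))\<^sup>2 \<le> (norm (x - p - c *\<^sub>R u))\<^sup>2"
      using d_le[of "p + c *\<^sub>R u"] pd unfolding diff_diff_eq by linarith
    also have "\<dots> = (norm (x - p))\<^sup>2 - 2 * c * inner (x - p) u + c\<^sup>2 * inner u u"
      unfolding power2_norm_eq_inner
      by (simp add: inner_diff_left inner_diff_right inner_commute power2_eq_square algebra_simps)
    also have "\<dots> = (norm (x - p))\<^sup>2 - (inner (x - p) u)\<^sup>2 / inner u u"
      unfolding c_def using u by (simp add: power2_eq_square field_simps)
    finally have "(inner (x - p) u)\<^sup>2 / inner u u \<le> 0" by simp
    moreover have "(inner (x - p) u)\<^sup>2 / inner u u > 0" using c u by simp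
    ultimately show False by simp
  qed
  then show thesis using that pM by blast
qed

lemma riesz_representation:
  fixes f :: "'a::{real_inner,complete_space} \<Rightarrow> real"
  assumes "bounded_linear f"
  obtains z where "\<And>x. f x = inner x z"
proof (cases "\<forall>x. f x = 0")
  case True
  then show thesis using that[of 0] by simp
next
  case False
  interpret f: bounded_linear f by fact
  obtain u where u: "f u \<noteq> 0" using False by blast
  define M where "M = {x. f x = 0}"
  have "subspace M" by (auto simp: M_def subspace_def f.add f.scaleR f.zero)
  moreover have "closed M" unfolding M_def
    by (intro closed_Collect_eq continuous_intros linear_continuous_on assms)
  ultimately obtain p where p: "p \<in> M" "\<And>y. y \<in> M \<Longrightarrow> inner (u - p) y = 0"
    using orthogonal_decomposition by metis
  define q where "q = u - p"
  have fq: "f q \<noteq> 0" using u p(1) by (simp add: q_def f.diff M_def)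
  then have qq: "inner q q \<noteq> 0" by (auto simp: f.zero)
  have "f x = inner x ((f q / inner q q) *\<^sub>R q)" for x
  proof -
    have "x - (f x / f q) *\<^sub>R q \<in> M" using fq by (simp add: M_def f.diff f.scaleR)
    from p(2)[OF this] have "inner x q = (f x / f q) * inner q q"
      unfolding q_def[symmetric] by (simp add: inner_diff_right inner_commute)
    then show ?thesis using fq qq by simp
  qed
  then show thesis using that by blast
qed

lemma adjoint_exists:
  fixes T :: "'a::{real_inner,complete_space} \<Rightarrow>\<^sub>L 'a"
  obtains S :: "'a \<Rightarrow>\<^sub>L 'a" where "\<And>x y. inner (T x) y = inner x (S y)"
proof -
  have "\<exists>z. \<forall>x. inner (T x) y = inner x z" for y
  proof -
    have "bounded_linear (\<lambda>x. inner (T x) y)"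
      by (intro bounded_linear_intros)
    from riesz_representation[OF this] show ?thesis by metis
  qed
  then obtain s where s: "\<And>x y. inner (T x) y = inner x (s y)" by metis
  have "bounded_linear s"
  proof (rule bounded_linear_intro[where K = "norm T"])
    show "s (x + y) = s x + s y" for x y
      by (rule vector_eq_ldot[THEN iffD1]) (simp add: s[symmetric] inner_add_right)
    show "s (r *\<^sub>R x) = r *\<^sub>R s x" for r x
      by (rule vector_eq_ldot[THEN iffD1]) (simp add: s[symmetric])
    show "norm (s x) \<le> norm x * norm T" for x
    proof -
      have "norm (s x) * norm (s x) = inner (T (s x)) x"
        by (simp add: s power2_norm_eq_inner[symmetric] power2_eq_square)
      also have "\<dots> \<le> norm (T (s x)) * norm x" by (rule norm_cauchy_schwarz)
      also have "\<dots> \<le> (norm T * norm (s x)) * norm x"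
        by (intro mult_right_mono norm_blinfun) auto
      finally have "norm (s x) * norm (s x) \<le> norm (s x) * (norm x * norm T)"
        by (simp add: mult_ac)
      then show ?thesis by (cases "norm (s x) = 0") auto
    qed
  qed
  then show thesis using that[of "Blinfun s"] s by (simp add: bounded_linear_Blinfun_apply)
qed

lemma cinner_scaleC_right: "cinner x (a *\<^sub>C y) = cnj a * cinner x (y::'a::complex_inner)"
  by (metis cinner_commute cinner_scaleC_left complex_cnj_mult)

lemma norm_scaleC: "norm (a *\<^sub>C x) = cmod a * norm (x::'a::complex_inner)"
proof -
  have "(norm (a *\<^sub>C x))\<^sup>2 = Re (a * cnj a * cinner x x)"
    by (simp add: power2_norm_eq_inner inner_eq_Re_cinner cinner_scaleC_left cinner_scaleC_right mult_ac)
  also have "\<dots> = (cmod a * norm x)\<^sup>2"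
    by (simp add: complex_norm_square[symmetric] power_mult_distrib power2_norm_eq_inner
        inner_eq_Re_cinner del: of_real_power)
  finally show ?thesis by (simp add: power2_eq_iff_nonneg)
qed

text \<open>Multiplication by the imaginary unit.  A real-linear operator is complex-linear iff it
  commutes with this one, so that complex linearity passes to any operator obtained from \<open>A\<close> which
  commutes with everything that commutes with \<open>A\<close>.\<close>

definition imag_op :: "'a::complex_inner \<Rightarrow>\<^sub>L 'a"
  where "imag_op = Blinfun (\<lambda>x. \<i> *\<^sub>C x)"

lemma imag_op_apply: "imag_op x = \<i> *\<^sub>C x"
proof -
  have "bounded_linear (\<lambda>x::'a. \<i> *\<^sub>C x)"
  proof (rule bounded_linear_intro[where K = 1])
    show "\<i> *\<^sub>C (r *\<^sub>R x) = r *\<^sub>R (\<i> *\<^sub>C x)" for r and x :: 'a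
      by (simp add: scaleC_of_real[symmetric] scaleC_scaleC mult.commute)
  qed (simp_all add: scaleC_add_right norm_scaleC)
  then show ?thesis by (simp add: imag_op_def bounded_linear_Blinfun_apply)
qed

lemma scaleC_eq: "c *\<^sub>C x = Re c *\<^sub>R x + Im c *\<^sub>R (\<i> *\<^sub>C (x::'a::complex_inner))"
proof -
  have "c = of_real (Re c) + of_real (Im c) * \<i>" by (simp add: complex_eq_iff)
  then have "c *\<^sub>C x = (of_real (Re c) + of_real (Im c) * \<i>) *\<^sub>C x" by simp
  then show ?thesis by (simp only: scaleC_add_left scaleC_scaleC[symmetric] scaleC_of_real)
qed

lemma clinear_op_iff: "clinear_op T \<longleftrightarrow> T o\<^sub>L imag_op = imag_op o\<^sub>L T"
proof
  assume "clinear_op T"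
  then show "T o\<^sub>L imag_op = imag_op o\<^sub>L T"
    by (intro blinfun_eqI) (simp add: clinear_op_def imag_op_apply)
next
  assume "T o\<^sub>L imag_op = imag_op o\<^sub>L T"
  then have "T (\<i> *\<^sub>C x) = \<i> *\<^sub>C T x" for x
    by (metis blinfun_apply_blinfun_compose imag_op_apply)
  then show "clinear_op T"
    unfolding clinear_op_def
    by (metis scaleC_eq blinfun.add_right blinfun.scaleR_right)
qed

text \<open>This reduces the complex adjoint to the real one.\<close>

lemma cinner_eq_inner: "cinner x y = Complex (inner x y) (inner ((- \<i>) *\<^sub>C x) y)"
  by (simp add: complex_eq_iff inner_eq_Re_cinner cinner_scaleC_left)

lemma adj_props:
  fixes T :: "'a::chilbert_space \<Rightarrow>\<^sub>L 'a"
  assumes T: "clinear_op T"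
  shows clinear_adj: "clinear_op (adj T)"
    and inner_adj: "inner (T x) y = inner x (adj T y)"
proof -
  obtain S :: "'a \<Rightarrow>\<^sub>L 'a" where S: "\<And>x y. inner (T x) y = inner x (S y)"
    using adjoint_exists[of T] by blast
  have c: "cinner (T x) y = cinner x (S y)" for x y
    using T by (simp add: cinner_eq_inner clinear_op_def S[symmetric])
  have "S (a *\<^sub>C y) = a *\<^sub>C S y" for a y
  proof (rule vector_eq_ldot[THEN iffD1], rule allI)
    fix z show "inner z (S (a *\<^sub>C y)) = inner z (a *\<^sub>C S y)"
      by (simp add: inner_eq_Re_cinner c[symmetric] cinner_scaleC_right)
  qed
  then have SC: "clinear_op S" by (simp add: clinear_op_def)
  have "adj T = S"
    unfolding adj_def
  proof (rule the_equality)
    show "clinear_op S \<and> (\<forall>x y. cinner (T x) y = cinner x (S y))" using SC c by blast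
    fix R assume R: "clinear_op R \<and> (\<forall>x y. cinner (T x) y = cinner x (R y))"
    show "R = S"
    proof (rule blinfun_eqI, rule vector_eq_ldot[THEN iffD1], rule allI)
      fix y z show "inner z (R y) = inner z (S y)"
        using R by (simp add: inner_eq_Re_cinner c[symmetric])
    qed
  qed
  then show "clinear_op (adj T)" "inner (T x) y = inner x (adj T y)" using SC S by auto
qed

section \<open>Self-adjoint operators and polynomials in them\<close>

lemma blinfun_eq_iff: "A = B \<longleftrightarrow> (\<forall>x. blinfun_apply A x = B x)"
  using blinfun_eqI by auto

lemma subspace_range: "subspace (range (blinfun_apply A))"
  by (intro linear_subspace_image subspace_UNIV bounded_linear.linear blinfun.bounded_linear_right)

lemma op_power_apply: "op_power T n x = (blinfun_apply T ^^ n) x"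
  by (induction n) auto

lemma op_power_add: "op_power T (m + k) = op_power T m o\<^sub>L op_power T k"
  by (rule blinfun_eqI) (simp add: op_power_apply funpow_add)

lemma op_power_commute:
  assumes "C o\<^sub>L T = T o\<^sub>L C"
  shows "C o\<^sub>L op_power T n = op_power T n o\<^sub>L C"
  by (induction n) (use assms in \<open>auto simp: blinfun_eq_iff\<close>)

lemma poly_op_altdef:
  assumes "degree p \<le> N"
  shows "poly_op p A = (\<Sum>i\<le>N. coeff p i *\<^sub>R op_power A i)"
  unfolding poly_op_def
  by (rule sum.mono_neutral_left) (use assms in \<open>auto simp: coeff_eq_0\<close>)

lemma poly_op_0 [simp]: "poly_op 0 A = 0"
  by (simp add: poly_op_def)

lemma poly_op_pCons [simp]:
  "poly_op (pCons a p) A = a *\<^sub>R id_blinfun + (A o\<^sub>L poly_op p A)"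
proof -
  have "poly_op (pCons a p) A
      = (\<Sum>i\<le>Suc (degree p). coeff (pCons a p) i *\<^sub>R op_power A i)"
    by (rule poly_op_altdef) (rule degree_pCons_le)
  also have "\<dots> = a *\<^sub>R id_blinfun + (\<Sum>i\<le>degree p. coeff p i *\<^sub>R (A o\<^sub>L op_power A i))"
    by (subst sum.atMost_Suc_shift) simp
  also have "(\<Sum>i\<le>degree p. coeff p i *\<^sub>R (A o\<^sub>L op_power A i)) = A o\<^sub>L poly_op p A"
    by (simp add: poly_op_def blinfun_eq_iff blinfun.sum_left blinfun.sum_right
        blinfun.scaleR_left blinfun.scaleR_right)
  finally show ?thesis .
qed

lemma poly_op_add: "poly_op (p + q) A = poly_op p A + poly_op q A"
proof (induction p q rule: poly_induct2)
  case (pCons a p b q)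
  then show ?case by (simp add: blinfun_eq_iff blinfun.bilinear_simps algebra_simps)
qed simp

lemma poly_op_smult: "poly_op (smult c p) A = c *\<^sub>R poly_op p A"
  by (induction p) (auto simp: blinfun_eq_iff blinfun.bilinear_simps algebra_simps)

lemma poly_op_diff: "poly_op (p - q) A = poly_op p A - poly_op q A"
  using poly_op_add[of "p - q" q A] by (simp add: algebra_simps)

lemma poly_op_mult: "poly_op (p * q) A = poly_op p A o\<^sub>L poly_op q A"
  by (induction p)
    (auto simp: poly_op_add poly_op_smult blinfun_eq_iff blinfun.bilinear_simps)

lemma poly_op_commute:
  assumes "C o\<^sub>L A = A o\<^sub>L C"
  shows "C o\<^sub>L poly_op p A = poly_op p A o\<^sub>L C"
  by (induction p) (use assms in \<open>auto simp: blinfun_eq_iff blinfun.bilinear_simps\<close>)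

lemma poly_op_eigenvector:
  fixes A :: "'a::real_normed_vector \<Rightarrow>\<^sub>L 'a"
  assumes "A x = t *\<^sub>R x"
  shows "poly_op p A x = poly p t *\<^sub>R x"
  by (induction p)
    (auto simp: assms blinfun.bilinear_simps scaleR_left_distrib mult.commute)

text \<open>Self-adjointness for the real inner product.  For complex-linear operators it is equivalent to
  self-adjointness for the complex one.\<close>

definition self_adjoint :: "('a::real_inner \<Rightarrow>\<^sub>L 'a) \<Rightarrow> bool"
  where "self_adjoint A \<longleftrightarrow> (\<forall>x y. inner (A x) y = inner x (A y))"

text \<open>Positivity includes self-adjointness, which does not follow from the sign of the quadratic
  form on a real inner product space.\<close>

definition positive_op :: "('a::real_inner \<Rightarrow>\<^sub>L 'a) \<Rightarrow> bool"
  where "positive_op A \<longleftrightarrow> self_adjoint A \<and> (\<forall>x. 0 \<le> inner (A x) x)"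

lemma self_adjointD: "self_adjoint A \<Longrightarrow> inner (A x) y = inner x (A y)"
  by (simp add: self_adjoint_def)

lemma self_adjoint_id: "self_adjoint id_blinfun"
  by (simp add: self_adjoint_def)

lemma self_adjoint_diff: "self_adjoint A \<Longrightarrow> self_adjoint B \<Longrightarrow> self_adjoint (A - B)"
  by (simp add: self_adjoint_def blinfun.bilinear_simps inner_diff_left inner_diff_right)

lemma self_adjoint_scaleR: "self_adjoint A \<Longrightarrow> self_adjoint (r *\<^sub>R A)"
  by (simp add: self_adjoint_def blinfun.bilinear_simps)

lemma self_adjoint_compose:
  assumes "self_adjoint A" "self_adjoint B" "A o\<^sub>L B = B o\<^sub>L A"
  shows "self_adjoint (A o\<^sub>L B)"
  unfolding self_adjoint_def
  by (metis assms blinfun_apply_blinfun_compose self_adjointD)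

lemma self_adjoint_poly_op:
  assumes "self_adjoint A"
  shows "self_adjoint (poly_op p A)"
proof (induction p)
  case (pCons a p)
  have "self_adjoint (A o\<^sub>L poly_op p A)"
    by (intro self_adjoint_compose assms pCons poly_op_commute) simp
  then show ?case
    by (simp add: self_adjoint_def blinfun.bilinear_simps inner_add_left inner_add_right)
qed (simp add: self_adjoint_def)

text \<open>Existence of a bounded two-sided inverse.\<close>

definition invertible_op :: "('a::real_normed_vector \<Rightarrow>\<^sub>L 'a) \<Rightarrow> bool"
  where "invertible_op A \<longleftrightarrow> (\<exists>S. S o\<^sub>L A = id_blinfun \<and> A o\<^sub>L S = id_blinfun)"

lemma real_spectrum_iff: "t \<in> real_spectrum A \<longleftrightarrow> \<not> invertible_op (A - t *\<^sub>R id_blinfun)"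
  by (simp add: real_spectrum_def invertible_op_def)

lemma invertible_op_compose:
  assumes "invertible_op A" "invertible_op B"
  shows "invertible_op (A o\<^sub>L B)"
proof -
  obtain R S where "R o\<^sub>L A = id_blinfun" "A o\<^sub>L R = id_blinfun"
    "S o\<^sub>L B = id_blinfun" "B o\<^sub>L S = id_blinfun"
    using assms by (auto simp: invertible_op_def)
  then show ?thesis unfolding invertible_op_def
    by (intro exI[of _ "S o\<^sub>L R"]) (simp add: blinfun_eq_iff)
qed

lemma invertible_op_bounded_below:
  assumes "invertible_op A"
  obtains c where "c > 0" "\<And>x. c * norm x \<le> norm (A x)"
proof -
  obtain S where S: "S o\<^sub>L A = id_blinfun" using assms by (auto simp: invertible_op_def)
  have "norm x \<le> (norm S + 1) * norm (A x)" for x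
  proof -
    have "x = S (A x)" by (metis S blinfun_apply_blinfun_compose blinfun_apply_id_blinfun id_apply)
    then have "norm x \<le> norm S * norm (A x)" by (metis norm_blinfun)
    then show ?thesis by (smt (verit) mult_right_mono norm_ge_zero)
  qed
  moreover have "norm S + 1 > 0" by (smt (verit) norm_ge_zero)
  ultimately show thesis
    by (intro that[of "1 / (norm S + 1)"]) (auto simp: field_simps)
qed

text \<open>The range of a self-adjoint operator that is bounded below is closed, and its orthogonal
  complement is the kernel, which is trivial.\<close>

lemma self_adjoint_bounded_below_invertible:
  fixes A :: "'a::{real_inner,complete_space} \<Rightarrow>\<^sub>L 'a"
  assumes A: "self_adjoint A" and c: "c > 0" "\<And>x. c * norm x \<le> norm (A x)"
  shows "invertible_op A"
proof -
  have "closed (range A)"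
  proof (rule closed_sequential_limits[THEN iffD2], intro allI impI)
    fix u l assume ul: "(\<forall>n. u n \<in> range A) \<and> u \<longlonglongrightarrow> l"
    then have "\<forall>n. \<exists>v. u n = A v" by blast
    then obtain v where v: "\<And>n. u n = A (v n)" by metis
    have "Cauchy v"
    proof (rule CauchyI)
      fix e :: real assume "e > 0"
      have "Cauchy u" using ul LIMSEQ_imp_Cauchy by blast
      then obtain M where M: "\<And>m n. m \<ge> M \<Longrightarrow> n \<ge> M \<Longrightarrow> norm (u m - u n) < c * e"
        using CauchyD[of u "c * e"] c \<open>e > 0\<close> by auto
      have "norm (v m - v n) < e" if "m \<ge> M" "n \<ge> M" for m n
      proof -
        have "c * norm (v m - v n) \<le> norm (u m - u n)"
          using c(2)[of "v m - v n"] by (simp add: v blinfun.diff_right)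
        then have "c * norm (v m - v n) < c * e" using M[OF that] by linarith
        then show ?thesis using c(1) by simp
      qed
      then show "\<exists>M. \<forall>m\<ge>M. \<forall>n\<ge>M. norm (v m - v n) < e" by blast
    qed
    then obtain x where "v \<longlonglongrightarrow> x" using Cauchy_convergent convergentD by blast
    then have "(\<lambda>n. A (v n)) \<longlonglongrightarrow> A x" by (intro tendsto_intros)
    moreover have "(\<lambda>n. A (v n)) \<longlonglongrightarrow> l" using ul by (simp add: v[symmetric])
    ultimately have "l = A x" using LIMSEQ_unique by blast
    then show "l \<in> range A" by blast
  qed
  have surj: "y \<in> range A" for y
  proof -
    obtain p where p: "p \<in> range A" "\<And>z. z \<in> range A \<Longrightarrow> inner (y - p) z = 0"
      using orthogonal_decomposition[OF subspace_range \<open>closed _\<close>] by metis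
    have "inner (A (y - p)) z = 0" for z
      using p(2)[of "A z"] self_adjointD[OF A] by simp
    then have "A (y - p) = 0" by (metis inner_eq_zero_iff)
    then have "c * norm (y - p) \<le> 0" using c(2)[of "y - p"] by simp
    then have "y = p" using c(1) by (simp add: mult_le_0_iff)
    then show ?thesis using p by simp
  qed
  have inj: "x = y" if "A x = A y" for x y
    using c(2)[of "x - y"] c(1) that by (simp add: blinfun.diff_right mult_le_0_iff)
  define s where "s = inv A"
  have As: "A (s y) = y" for y unfolding s_def by (rule f_inv_into_f[OF surj])
  have "bounded_linear s"
  proof (rule bounded_linear_intro[where K = "1 / c"])
    show "s (x + y) = s x + s y" for x y by (rule inj) (simp add: As blinfun.add_right)
    show "s (r *\<^sub>R x) = r *\<^sub>R s x" for r x by (rule inj) (simp add: As blinfun.scaleR_right)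
    show "norm (s x) \<le> norm x * (1 / c)" for x
      using c(2)[of "s x"] c(1) by (simp add: As field_simps)
  qed
  then have "Blinfun s x = s x" for x by (simp add: bounded_linear_Blinfun_apply)
  moreover have "s (A x) = x" for x by (rule inj) (simp add: As)
  ultimately show ?thesis unfolding invertible_op_def
    by (intro exI[of _ "Blinfun s"]) (simp add: blinfun_eq_iff As)
qed

lemma coercive_invertible:
  fixes A :: "'a::{real_inner,complete_space} \<Rightarrow>\<^sub>L 'a"
  assumes "self_adjoint A" "c > 0" "\<And>x. c * (norm x)\<^sup>2 \<le> \<bar>inner (A x) x\<bar>"
  shows "invertible_op A"
proof (rule self_adjoint_bounded_below_invertible[OF assms(1,2)])
  fix x
  have "c * norm x * norm x \<le> \<bar>inner (A x) x\<bar>"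
    using assms(3)[of x] by (simp add: power2_eq_square mult.assoc)
  also have "\<dots> \<le> norm (A x) * norm x" by (rule Cauchy_Schwarz_ineq2)
  finally show "c * norm x \<le> norm (A x)"
    by (cases "x = 0") auto
qed

lemma abs_inner_blinfun_le:
  fixes A :: "'a::real_inner \<Rightarrow>\<^sub>L 'a"
  shows "\<bar>inner (A x) x\<bar> \<le> norm A * (norm x)\<^sup>2"
proof -
  have "\<bar>inner (A x) x\<bar> \<le> norm (A x) * norm x" by (rule Cauchy_Schwarz_ineq2)
  also have "\<dots> \<le> norm A * norm x * norm x" by (intro mult_right_mono norm_blinfun) auto
  finally show ?thesis by (simp add: power2_eq_square mult.assoc)
qed

lemma real_spectrum_bounded:
  fixes A :: "'a::chilbert_space \<Rightarrow>\<^sub>L 'a"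
  assumes A: "self_adjoint A"
  shows "real_spectrum A \<subseteq> {- norm A..norm A}"
proof (rule subsetI, rule ccontr)
  fix t assume t: "t \<in> real_spectrum A" "t \<notin> {- norm A..norm A}"
  have "invertible_op (A - t *\<^sub>R id_blinfun)"
  proof (rule coercive_invertible)
    show "self_adjoint (A - t *\<^sub>R id_blinfun)"
      by (intro self_adjoint_diff self_adjoint_scaleR self_adjoint_id A)
    show "\<bar>t\<bar> - norm A > 0" using t(2) by auto
    show "(\<bar>t\<bar> - norm A) * (norm x)\<^sup>2 \<le> \<bar>inner ((A - t *\<^sub>R id_blinfun) x) x\<bar>" for x
    proof -
      have "inner ((A - t *\<^sub>R id_blinfun) x) x = inner (A x) x - t * (norm x)\<^sup>2"
        by (simp add: blinfun.bilinear_simps inner_diff_left power2_norm_eq_inner)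
      moreover have "\<bar>t * (norm x)\<^sup>2\<bar> = \<bar>t\<bar> * (norm x)\<^sup>2" by (simp add: abs_mult)
      ultimately show ?thesis using abs_inner_blinfun_le[of A x]
        by (simp add: left_diff_distrib)
    qed
  qed
  then show False using t(1) by (simp add: real_spectrum_iff)
qed

lemma real_spectrum_positive:
  fixes A :: "'a::chilbert_space \<Rightarrow>\<^sub>L 'a"
  assumes A: "positive_op A"
  shows "real_spectrum A \<subseteq> {0..norm A}"
proof -
  have sa: "self_adjoint A" using A by (simp add: positive_op_def)
  have "t \<ge> 0" if t: "t \<in> real_spectrum A" for t
  proof (rule ccontr)
    assume neg: "\<not> t \<ge> 0"
    have "invertible_op (A - t *\<^sub>R id_blinfun)"
    proof (rule coercive_invertible)
      show "self_adjoint (A - t *\<^sub>R id_blinfun)"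
        by (intro self_adjoint_diff self_adjoint_scaleR self_adjoint_id sa)
      show "- t > 0" using neg by simp
      show "- t * (norm x)\<^sup>2 \<le> \<bar>inner ((A - t *\<^sub>R id_blinfun) x) x\<bar>" for x
      proof -
        have "inner ((A - t *\<^sub>R id_blinfun) x) x = inner (A x) x - t * (norm x)\<^sup>2"
          by (simp add: blinfun.bilinear_simps inner_diff_left power2_norm_eq_inner)
        moreover have "inner (A x) x \<ge> 0" using A by (simp add: positive_op_def)
        ultimately show ?thesis by linarith
      qed
    qed
    then show False using t by (simp add: real_spectrum_iff)
  qed
  then show ?thesis using real_spectrum_bounded[OF sa] by fastforce
qed

lemma poly_map_of_real_add:
  "poly (map_poly of_real (p + q)) (z::complex)
     = poly (map_poly of_real p) z + poly (map_poly of_real q) z"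
proof (induction p q rule: poly_induct2)
  case (pCons a p b q)
  then show ?case by (simp add: map_poly_pCons algebra_simps)
qed simp

lemma poly_map_of_real_mult:
  "poly (map_poly of_real (p * q)) (z::complex)
     = poly (map_poly of_real p) z * poly (map_poly of_real q) z"
proof (induction p)
  case (pCons a p)
  have "map_poly complex_of_real (smult a q) = smult (of_real a) (map_poly of_real q)"
    by (rule map_poly_smult) auto
  then show ?case using pCons
    by (simp add: poly_map_of_real_add map_poly_pCons algebra_simps)
qed simp

lemma poly_map_of_real: "poly (map_poly of_real p) (complex_of_real x) = of_real (poly p x)"
  by (induction p) (auto simp: map_poly_pCons)

text \<open>Spectral mapping for polynomials, in the direction needed: over the reals a polynomial
  factors into linear and positive definite quadratic factors, and the latter are always
  invertible at a self-adjoint operator.\<close>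

lemma invertible_poly_op:
  fixes A :: "'a::chilbert_space \<Rightarrow>\<^sub>L 'a"
  assumes A: "self_adjoint A"
  shows "q \<noteq> 0 \<Longrightarrow> (\<And>t. t \<in> real_spectrum A \<Longrightarrow> poly q t \<noteq> 0) \<Longrightarrow> invertible_op (poly_op q A)"
proof (induction "degree q" arbitrary: q rule: less_induct)
  case less
  show ?case
  proof (cases "degree q = 0")
    case True
    then obtain a where a: "q = [:a:]" using degree_eq_zeroE by blast
    with less.prems have "a \<noteq> 0" by simp
    then show ?thesis unfolding a invertible_op_def
      by (intro exI[of _ "(1 / a) *\<^sub>R id_blinfun"])
        (simp add: blinfun_eq_iff blinfun.bilinear_simps)
  next
    case False
    define Q where "Q = map_poly complex_of_real q"
    have "degree Q = degree q" by (simp add: Q_def degree_map_poly)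
    then obtain z where z: "poly Q z = 0"
      using False fundamental_theorem_of_algebra_alt[of Q] by fastforce
    show ?thesis
    proof (cases "Im z = 0")
      case True
      then have "z = of_real (Re z)" by (simp add: complex_eq_iff)
      then have "poly q (Re z) = 0" using z unfolding Q_def
        by (metis of_real_eq_0_iff poly_map_of_real)
      then obtain r where r: "q = [:- Re z, 1:] * r" by (metis poly_eq_0_iff_dvd dvd_def)
      then have "r \<noteq> 0" using less.prems by auto
      then have "degree r < degree q" unfolding r by (subst degree_mult_eq) auto
      moreover have "poly r t \<noteq> 0" if "t \<in> real_spectrum A" for t
        using less.prems(2)[OF that] r by auto
      ultimately have "invertible_op (poly_op r A)" using less.hyps \<open>r \<noteq> 0\<close> by blast
      moreover have "invertible_op (A - Re z *\<^sub>R id_blinfun)"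
        using less.prems(2)[of "Re z"] \<open>poly q (Re z) = 0\<close> real_spectrum_iff by blast
      moreover have "poly_op [:- Re z, 1:] A = A - Re z *\<^sub>R id_blinfun"
        by (simp add: blinfun_eq_iff blinfun.bilinear_simps)
      ultimately show ?thesis unfolding r poly_op_mult by (metis invertible_op_compose)
    next
      case False
      define d where "d = [:(cmod z)\<^sup>2, - 2 * Re z, 1:]"
      have d0: "d \<noteq> 0" "degree d = 2" by (auto simp: d_def)
      have dz: "poly (map_poly complex_of_real d) z = 0"
        by (simp add: d_def map_poly_pCons complex_eq_iff cmod_power2
            power2_eq_square[of "Re z"] power2_eq_square[of "Im z"] algebra_simps)
      \<comment> \<open>\<open>d\<close> is the minimal polynomial of the non-real number \<open>z\<close> over the reals; the remainder has
        degree at most one and vanishes at \<open>z\<close>.\<close>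
      have "q mod d = 0"
      proof (rule ccontr)
        assume n0: "q mod d \<noteq> 0"
        define R where "R = q mod d"
        have dR: "degree R < 2" using degree_mod_less'[OF d0(1) n0] d0 by (simp add: R_def)
        define a where "a = coeff R 0"
        obtain R' where R': "R = pCons a R'" by (metis a_def coeff_pCons_0 pCons_cases)
        then have "degree R' = 0" using dR by (auto split: if_splits)
        then obtain b where "R' = [:b:]" using degree_eq_zeroE by blast
        then have R: "R = [:a, b:]" using R' by simp
        have "q = d * (q div d) + R" by (simp add: R_def)
        then have "poly (map_poly complex_of_real R) z = 0"
          using z dz unfolding Q_def
          by (metis add_0 mult_zero_left poly_map_of_real_add poly_map_of_real_mult)
        then have "of_real a + z * of_real b = 0" by (simp add: R map_poly_pCons)
        then have "b = 0 \<and> a = 0" using False by (auto simp: complex_eq_iff)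
        then show False using n0 R by (simp add: R_def)
      qed
      then obtain r where r: "q = d * r" by (metis dvd_def mod_0_imp_dvd)
      then have "r \<noteq> 0" using less.prems by auto
      then have "degree r < degree q" unfolding r using d0 by (subst degree_mult_eq) auto
      moreover have "poly r t \<noteq> 0" if "t \<in> real_spectrum A" for t
        using less.prems(2)[OF that] r by auto
      ultimately have "invertible_op (poly_op r A)" using less.hyps \<open>r \<noteq> 0\<close> by blast
      moreover have "invertible_op (poly_op d A)"
      proof (rule coercive_invertible)
        show "self_adjoint (poly_op d A)" by (rule self_adjoint_poly_op[OF A])
        show "(Im z)\<^sup>2 > 0" using False by simp
        show "(Im z)\<^sup>2 * (norm x)\<^sup>2 \<le> \<bar>inner (poly_op d A x) x\<bar>" for x
        proof -
          have "inner (poly_op d A x) x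
              = inner (A (A x)) x - 2 * Re z * inner (A x) x + (cmod z)\<^sup>2 * inner x x"
            by (simp add: d_def blinfun.bilinear_simps inner_add_left inner_diff_left)
          also have "inner (A (A x)) x = inner (A x) (A x)" by (rule self_adjointD[OF A])
          also have "inner (A x) (A x) - 2 * Re z * inner (A x) x + (cmod z)\<^sup>2 * inner x x
              = (norm (A x - Re z *\<^sub>R x))\<^sup>2 + (Im z)\<^sup>2 * (norm x)\<^sup>2"
            unfolding cmod_power2 unfolding power2_norm_eq_inner
            by (simp add: inner_diff_left inner_diff_right inner_commute power2_eq_square
                algebra_simps)
          finally show ?thesis by simp
        qed
      qed
      ultimately show ?thesis unfolding r poly_op_mult by (metis invertible_op_compose)
    qed
  qed
qed

text \<open>Vectors on which \<open>B\<close> nearly attains its norm are nearly annihilated by \<open>B\<^sup>2 - \<parallel>B\<parallel>\<^sup>2\<close>.\<close>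

lemma not_invertible_square_minus_norm:
  fixes B :: "'a::real_inner \<Rightarrow>\<^sub>L 'a"
  assumes B: "self_adjoint B" and nontrivial: "(id_blinfun :: 'a \<Rightarrow>\<^sub>L 'a) \<noteq> 0"
  shows "\<not> invertible_op ((B o\<^sub>L B) - (norm B)\<^sup>2 *\<^sub>R id_blinfun)"
proof
  define m where "m = norm B"
  assume inv: "invertible_op ((B o\<^sub>L B) - (norm B)\<^sup>2 *\<^sub>R id_blinfun)"
  have m: "m > 0"
  proof (rule ccontr)
    assume "\<not> m > 0"
    then have "B = 0" by (simp add: m_def)
    with inv nontrivial show False by (auto simp: invertible_op_def)
  qed
  obtain e where e: "e > 0" "\<And>x. e * norm x \<le> norm (B (B x) - m\<^sup>2 *\<^sub>R x)"
    using invertible_op_bounded_below[OF inv] by (auto simp: m_def blinfun.bilinear_simps)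
  have est: "2 * m\<^sup>2 * (norm (B x))\<^sup>2 \<le> (2 * m^4 - e\<^sup>2) * (norm x)\<^sup>2" for x
  proof -
    have "(e * norm x)\<^sup>2 \<le> (norm (B (B x) - m\<^sup>2 *\<^sub>R x))\<^sup>2"
      using e(2)[of x] e(1) by (intro power_mono) auto
    also have "\<dots> = (norm (B (B x)))\<^sup>2 - 2 * m\<^sup>2 * inner (B (B x)) x + m^4 * (norm x)\<^sup>2"
      unfolding power2_norm_eq_inner
      by (simp add: inner_diff_left inner_diff_right inner_commute power2_eq_square
          power4_eq_xxxx algebra_simps)
    also have "inner (B (B x)) x = (norm (B x))\<^sup>2"
      by (simp add: self_adjointD[OF B] power2_norm_eq_inner)
    also have "(norm (B (B x)))\<^sup>2 \<le> (m * (m * norm x))\<^sup>2"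
    proof (rule power_mono)
      have "norm (B (B x)) \<le> m * norm (B x)" unfolding m_def by (rule norm_blinfun)
      also have "\<dots> \<le> m * (m * norm x)"
        using m norm_blinfun[of B x] by (intro mult_left_mono) (auto simp: m_def)
      finally show "norm (B (B x)) \<le> m * (m * norm x)" .
    qed simp
    also have "(m * (m * norm x))\<^sup>2 = m^4 * (norm x)\<^sup>2"
      by (simp add: power_mult_distrib power2_eq_square power4_eq_xxxx)
    finally show ?thesis by (simp add: power_mult_distrib algebra_simps)
  qed
  define k where "k = (2 * m^4 - e\<^sup>2) / (2 * m\<^sup>2)"
  have k: "(norm (B x))\<^sup>2 \<le> k * (norm x)\<^sup>2" for x
    using est[of x] m by (simp add: k_def field_simps)
  have "norm (B x) \<le> sqrt (max k 0) * norm x" for x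
  proof (rule power2_le_imp_le)
    have "(norm (B x))\<^sup>2 \<le> max k 0 * (norm x)\<^sup>2"
      using k[of x] mult_right_mono[of k "max k 0" "(norm x)\<^sup>2"] by auto
    then show "(norm (B x))\<^sup>2 \<le> (sqrt (max k 0) * norm x)\<^sup>2"
      by (simp add: power_mult_distrib)
  qed simp
  then have "m \<le> sqrt (max k 0)" unfolding m_def by (intro norm_blinfun_bound) auto
  then have "m\<^sup>2 \<le> max k 0" using m by (metis real_le_rsqrt real_sqrt_le_iff real_sqrt_pow2_iff
        max.cobounded2 power_mono less_imp_le)
  moreover have "k < m\<^sup>2" using m e(1)
    by (simp add: k_def field_simps power2_eq_square power4_eq_xxxx)
  ultimately show False using m by (auto simp: max_def split: if_splits)
qed

text \<open>The polynomial \<open>p\<^sup>2 - \<parallel>p(A)\<parallel>\<^sup>2\<close> gives a non-invertible operator at \<open>A\<close>, hence has a zero in the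
  spectrum of \<open>A\<close> unless it is the zero polynomial.  On the zero space the spectrum is empty and
  all operators are zero.\<close>

lemma norm_poly_op_le:
  fixes A :: "'a::chilbert_space \<Rightarrow>\<^sub>L 'a"
  assumes A: "self_adjoint A" and c: "c \<ge> 0" and p: "\<And>t. t \<in> real_spectrum A \<Longrightarrow> \<bar>poly p t\<bar> \<le> c"
  shows "norm (poly_op p A) \<le> c"
proof (cases "(id_blinfun :: 'a \<Rightarrow>\<^sub>L 'a) = 0")
  case True
  have "B = 0" for B :: "'a \<Rightarrow>\<^sub>L 'a"
  proof (rule blinfun_eqI)
    fix x
    have "id_blinfun x = (0 :: 'a \<Rightarrow>\<^sub>L 'a) x" by (simp only: True)
    then have "x = 0" by simp
    then show "B x = (0 :: 'a \<Rightarrow>\<^sub>L 'a) x" by (simp add: blinfun.bilinear_simps)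
  qed
  from this[of "poly_op p A"] c show ?thesis by simp
next
  case False
  show ?thesis
  proof (rule ccontr)
    define m where "m = norm (poly_op p A)"
    assume "\<not> norm (poly_op p A) \<le> c"
    then have m: "m > c" by (simp add: m_def)
    have *: "\<exists>t\<in>real_spectrum A. poly (r * r) t = (norm (poly_op r A))\<^sup>2"
      if "r * r \<noteq> [:(norm (poly_op r A))\<^sup>2:]" for r
    proof (rule ccontr)
      assume "\<not> (\<exists>t\<in>real_spectrum A. poly (r * r) t = (norm (poly_op r A))\<^sup>2)"
      then have "invertible_op (poly_op (r * r - [:(norm (poly_op r A))\<^sup>2:]) A)"
        using that by (intro invertible_poly_op A) auto
      moreover have "poly_op [:(norm (poly_op r A))\<^sup>2:] A = (norm (poly_op r A))\<^sup>2 *\<^sub>R id_blinfun"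
        by simp
      ultimately show False
        using not_invertible_square_minus_norm[OF self_adjoint_poly_op[OF A] False]
        by (metis poly_op_diff poly_op_mult)
    qed
    \<comment> \<open>The case \<open>r(t) = t\<close> shows that the spectrum is nonempty, so that \<open>p\<^sup>2\<close> cannot be the constant
      \<open>m\<^sup>2\<close>.\<close>
    have "[:0, 1:] * [:0, 1:] \<noteq> [:(norm (poly_op [:0, 1:] A))\<^sup>2:]" by simp
    from *[OF this] obtain t where t: "t \<in> real_spectrum A" by blast
    have lt: "poly (p * p) t < m\<^sup>2" if "t \<in> real_spectrum A" for t
    proof -
      have "\<bar>poly p t\<bar> < m" using p[OF that] m by linarith
      then have "(poly p t)\<^sup>2 < m\<^sup>2" 
        using power_strict_mono[of "\<bar>poly p t\<bar>" m 2] by simp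
      then show ?thesis by (simp add: power2_eq_square)
    qed
    then have "p * p \<noteq> [:m\<^sup>2:]" using t by force
    then show False using * lt unfolding m_def by force
  qed
qed

section \<open>Continuous functional calculus\<close>

text \<open>Makes the bounded operators a complete space.\<close>

instance chilbert_space \<subseteq> banach ..

lemma polynomial_approximation:
  fixes f :: "real \<Rightarrow> real"
  assumes "compact K" "continuous_on K f"
  obtains p :: "nat \<Rightarrow> real poly" where "uniform_limit K (\<lambda>k t. poly (p k) t) f sequentially"
proof -
  have "\<exists>p :: real poly. \<forall>t\<in>K. \<bar>f t - poly p t\<bar> < inverse (Suc k)" for k :: nat
  proof -
    obtain g where g: "real_polynomial_function g" "\<And>t. t \<in> K \<Longrightarrow> \<bar>f t - g t\<bar> < inverse (Suc k)"
      using Stone_Weierstrass_real_polynomial_function[OF assms, of "inverse (Suc k)"] by auto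
    then obtain a :: "nat \<Rightarrow> real" and n where "g = (\<lambda>t. \<Sum>i\<le>n. a i * t ^ i)"
      using real_polynomial_function_iff_sum by auto
    then have "poly (\<Sum>i\<le>n. monom (a i) i) t = g t" for t
      by (simp add: poly_sum poly_monom)
    then show ?thesis using g(2) by metis
  qed
  then obtain p :: "nat \<Rightarrow> real poly"
    where p: "\<And>k t. t \<in> K \<Longrightarrow> \<bar>f t - poly (p k) t\<bar> < inverse (Suc k)"
    by metis
  have "uniform_limit K (\<lambda>k t. poly (p k) t) f sequentially"
  proof (rule uniform_limitI)
    fix e :: real assume "e > 0"
    then have "\<forall>\<^sub>F k in sequentially. inverse (real (Suc k)) < e"
      by (rule order_tendstoD(2)[OF LIMSEQ_inverse_real_of_nat])
    then show "\<forall>\<^sub>F k in sequentially. \<forall>t\<in>K. dist (poly (p k) t) (f t) < e"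
    proof eventually_elim
      case (elim k)
      show ?case using p[of _ k] elim by (force simp: dist_real_def abs_minus_commute)
    qed
  qed
  then show thesis by (rule that)
qed

text \<open>The functional calculus of \<open>A\<close> is used for functions that are continuous on a compact set
  \<open>K\<close> containing the spectrum, such as an interval.\<close>

locale spectrum_in =
  fixes A :: "'a::chilbert_space \<Rightarrow>\<^sub>L 'a" and K :: "real set"
  assumes A: "self_adjoint A" and K: "real_spectrum A \<subseteq> K" and compact_K: "compact K"
begin

lemma cont_fun_calc_exists:
  assumes f: "continuous_on K f"
  obtains B where
    "\<And>p. uniform_limit (real_spectrum A) (\<lambda>k t. poly (p k) t) f sequentially
      \<Longrightarrow> (\<lambda>k. poly_op (p k) A) \<longlonglongrightarrow> B"
proof -
  obtain q :: "nat \<Rightarrow> real poly" where "uniform_limit K (\<lambda>k t. poly (q k) t) f sequentially"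
    using polynomial_approximation[OF compact_K f] by blast
  then have q: "uniform_limit (real_spectrum A) (\<lambda>k t. poly (q k) t) f sequentially"
    using K by (rule uniform_limit_on_subset)
  have est: "norm (poly_op r A - poly_op s A) \<le> e"
    if "\<And>t. t \<in> real_spectrum A \<Longrightarrow> dist (poly r t) (f t) < e / 2"
      "\<And>t. t \<in> real_spectrum A \<Longrightarrow> dist (poly s t) (f t) < e / 2" "e > 0" for r s e
    unfolding poly_op_diff[symmetric]
  proof (rule norm_poly_op_le[OF A])
    fix t assume t: "t \<in> real_spectrum A"
    show "\<bar>poly (r - s) t\<bar> \<le> e" 
      using that(1,2)[OF t] unfolding dist_real_def poly_diff by linarith
  qed (use that in simp)
  have "Cauchy (\<lambda>k. poly_op (q k) A)"
  proof (rule CauchyI)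
    fix e :: real assume e: "e > 0"
    then obtain N where N: "\<And>k t. k \<ge> N \<Longrightarrow> t \<in> real_spectrum A \<Longrightarrow> dist (poly (q k) t) (f t) < (e/2) / 2"
      using uniform_limitD[OF q, of "(e/2)/2"] unfolding eventually_sequentially by auto
    have "norm (poly_op (q m) A - poly_op (q k) A) < e" if "m \<ge> N" "k \<ge> N" for m k
    proof -
      have "norm (poly_op (q m) A - poly_op (q k) A) \<le> e / 2"
        by (intro est N that half_gt_zero e)
      then show ?thesis using e by linarith
    qed
    then show "\<exists>N. \<forall>m\<ge>N. \<forall>k\<ge>N. norm (poly_op (q m) A - poly_op (q k) A) < e" by blast
  qed
  then obtain B where B: "(\<lambda>k. poly_op (q k) A) \<longlonglongrightarrow> B"
    using Cauchy_convergent convergentD by blast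
  have "(\<lambda>k. poly_op (p k) A) \<longlonglongrightarrow> B"
    if p: "uniform_limit (real_spectrum A) (\<lambda>k t. poly (p k) t) f sequentially" for p
  proof -
    have "(\<lambda>k. poly_op (p k) A - poly_op (q k) A) \<longlonglongrightarrow> 0"
    proof (rule tendstoI)
      fix e :: real assume e: "e > 0"
      then have "e / 2 / 2 > 0" by simp
      from uniform_limitD[OF p this] uniform_limitD[OF q this]
      show "\<forall>\<^sub>F k in sequentially. dist (poly_op (p k) A - poly_op (q k) A) 0 < e"
      proof eventually_elim
        case (elim k)
        have "norm (poly_op (p k) A - poly_op (q k) A) \<le> e / 2"
          by (intro est half_gt_zero e) (use elim in blast)+
        then show ?case using e by simp
      qed
    qed
    from tendsto_add[OF this B] show ?thesis by simp
  qed
  then show thesis using that by blast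
qed

text \<open>The definite description defining the functional calculus is thus meaningful: the operator
  \<open>B\<close> exists, and it is unique because approximating sequences of polynomials exist.\<close>

lemma tendsto_cont_fun_calc:
  assumes f: "continuous_on K f"
    and p: "uniform_limit (real_spectrum A) (\<lambda>k t. poly (p k) t) f sequentially"
  shows "(\<lambda>k. poly_op (p k) A) \<longlonglongrightarrow> cont_fun_calc f A"
proof -
  obtain B where B: "\<And>p. uniform_limit (real_spectrum A) (\<lambda>k t. poly (p k) t) f sequentially
      \<Longrightarrow> (\<lambda>k. poly_op (p k) A) \<longlonglongrightarrow> B"
    using cont_fun_calc_exists[OF f] by blast
  have "cont_fun_calc f A = B"
    unfolding cont_fun_calc_def
  proof (rule the_equality)
    fix C assume C: "\<forall>p. uniform_limit (real_spectrum A) (\<lambda>k t. poly (p k) t) f sequentially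
      \<longrightarrow> (\<lambda>k. poly_op (p k) A) \<longlonglongrightarrow> C"
    show "C = B" using C B p LIMSEQ_unique by blast
  qed (use B in blast)
  then show ?thesis using B[OF p] by simp
qed

lemma cont_fun_calc_sequence:
  assumes "continuous_on K f"
  obtains p :: "nat \<Rightarrow> real poly" where "uniform_limit K (\<lambda>k t. poly (p k) t) f sequentially"
    "(\<lambda>k. poly_op (p k) A) \<longlonglongrightarrow> cont_fun_calc f A"
proof -
  obtain p where p: "uniform_limit K (\<lambda>k t. poly (p k) t) f sequentially"
    using polynomial_approximation[OF compact_K assms] by blast
  show thesis
    by (rule that[OF p tendsto_cont_fun_calc[OF assms uniform_limit_on_subset[OF p K]]])
qed

lemma cont_fun_calc_cong:
  assumes "\<And>t. t \<in> K \<Longrightarrow> f t = g t"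
  shows "cont_fun_calc f A = cont_fun_calc g A"
proof -
  have "uniform_limit (real_spectrum A) (\<lambda>k t. poly (p k) t) f sequentially
    \<longleftrightarrow> uniform_limit (real_spectrum A) (\<lambda>k t. poly (p k) t) g sequentially"
    for p :: "nat \<Rightarrow> real poly"
    by (rule uniform_limit_cong') (use assms K in auto)
  then show ?thesis unfolding cont_fun_calc_def by simp
qed

lemma cont_fun_calc_poly: "cont_fun_calc (poly q) A = poly_op q A"
proof -
  have "(\<lambda>k::nat. poly_op q A) \<longlonglongrightarrow> cont_fun_calc (poly q) A"
    by (rule tendsto_cont_fun_calc) (auto intro!: continuous_intros uniform_limit_const)
  then show ?thesis using LIMSEQ_unique tendsto_const by blast
qed

lemma cont_fun_calc_mult:
  assumes f: "continuous_on K f" and g: "continuous_on K g"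
  shows "cont_fun_calc (\<lambda>t. f t * g t) A = cont_fun_calc f A o\<^sub>L cont_fun_calc g A"
proof -
  obtain p where p: "uniform_limit K (\<lambda>k t. poly (p k) t) f sequentially"
    "(\<lambda>k. poly_op (p k) A) \<longlonglongrightarrow> cont_fun_calc f A"
    using cont_fun_calc_sequence[OF f] by blast
  obtain q where q: "uniform_limit K (\<lambda>k t. poly (q k) t) g sequentially"
    "(\<lambda>k. poly_op (q k) A) \<longlonglongrightarrow> cont_fun_calc g A"
    using cont_fun_calc_sequence[OF g] by blast
  have "uniform_limit K (\<lambda>k t. poly (p k) t * poly (q k) t) (\<lambda>t. f t * g t) sequentially"
    by (rule uniform_lim_mult[OF p(1) q(1)])
      (intro compact_imp_bounded compact_continuous_image f g compact_K)+
  then have "uniform_limit (real_spectrum A) (\<lambda>k t. poly (p k * q k) t) (\<lambda>t. f t * g t) sequentially"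
    using K by (simp add: uniform_limit_on_subset)
  then have "(\<lambda>k. poly_op (p k * q k) A) \<longlonglongrightarrow> cont_fun_calc (\<lambda>t. f t * g t) A"
    by (intro tendsto_cont_fun_calc continuous_intros f g)
  moreover have "(\<lambda>k. poly_op (p k * q k) A) \<longlonglongrightarrow> (cont_fun_calc f A o\<^sub>L cont_fun_calc g A)"
    unfolding poly_op_mult
    by (rule bounded_bilinear.tendsto[OF bounded_bilinear_blinfun_compose p(2) q(2)])
  ultimately show ?thesis using LIMSEQ_unique by blast
qed

lemma cont_fun_calc_add:
  assumes f: "continuous_on K f" and g: "continuous_on K g"
  shows "cont_fun_calc (\<lambda>t. f t + g t) A = cont_fun_calc f A + cont_fun_calc g A"
proof -
  obtain p where p: "uniform_limit K (\<lambda>k t. poly (p k) t) f sequentially"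
    "(\<lambda>k. poly_op (p k) A) \<longlonglongrightarrow> cont_fun_calc f A"
    using cont_fun_calc_sequence[OF f] by blast
  obtain q where q: "uniform_limit K (\<lambda>k t. poly (q k) t) g sequentially"
    "(\<lambda>k. poly_op (q k) A) \<longlonglongrightarrow> cont_fun_calc g A"
    using cont_fun_calc_sequence[OF g] by blast
  have "uniform_limit K (\<lambda>k t. poly (p k + q k) t) (\<lambda>t. f t + g t) sequentially"
    using uniform_limit_add[OF p(1) q(1)] by simp
  then have "(\<lambda>k. poly_op (p k + q k) A) \<longlonglongrightarrow> cont_fun_calc (\<lambda>t. f t + g t) A"
    by (intro tendsto_cont_fun_calc continuous_intros f g uniform_limit_on_subset[OF _ K])
  moreover have "(\<lambda>k. poly_op (p k + q k) A) \<longlonglongrightarrow> cont_fun_calc f A + cont_fun_calc g A"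
    unfolding poly_op_add by (rule tendsto_add[OF p(2) q(2)])
  ultimately show ?thesis using LIMSEQ_unique by blast
qed

lemma cont_fun_calc_commute:
  assumes f: "continuous_on K f" and C: "C o\<^sub>L A = A o\<^sub>L C"
  shows "C o\<^sub>L cont_fun_calc f A = cont_fun_calc f A o\<^sub>L C"
proof -
  obtain p where p: "(\<lambda>k. poly_op (p k) A) \<longlonglongrightarrow> cont_fun_calc f A"
    using cont_fun_calc_sequence[OF f] by blast
  have "(\<lambda>k. C o\<^sub>L poly_op (p k) A) \<longlonglongrightarrow> (C o\<^sub>L cont_fun_calc f A)"
    by (rule bounded_bilinear.tendsto[OF bounded_bilinear_blinfun_compose tendsto_const p])
  moreover have "(\<lambda>k. poly_op (p k) A o\<^sub>L C) \<longlonglongrightarrow> (cont_fun_calc f A o\<^sub>L C)"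
    by (rule bounded_bilinear.tendsto[OF bounded_bilinear_blinfun_compose p tendsto_const])
  ultimately show ?thesis using LIMSEQ_unique by (simp add: poly_op_commute[OF C])
qed

lemma self_adjoint_cont_fun_calc:
  assumes f: "continuous_on K f"
  shows "self_adjoint (cont_fun_calc f A)"
  unfolding self_adjoint_def
proof (intro allI)
  fix x y
  obtain p where p: "(\<lambda>k. poly_op (p k) A) \<longlonglongrightarrow> cont_fun_calc f A"
    using cont_fun_calc_sequence[OF f] by blast
  have "(\<lambda>k. inner (poly_op (p k) A x) y) \<longlonglongrightarrow> inner (cont_fun_calc f A x) y"
    by (intro tendsto_intros p)
  moreover have "(\<lambda>k. inner x (poly_op (p k) A y)) \<longlonglongrightarrow> inner x (cont_fun_calc f A y)"
    by (intro tendsto_intros p)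
  ultimately show "inner (cont_fun_calc f A x) y = inner x (cont_fun_calc f A y)"
    using LIMSEQ_unique by (simp add: self_adjointD[OF self_adjoint_poly_op[OF A]])
qed

lemma positive_cont_fun_calc:
  assumes f: "continuous_on K f" and nonneg: "\<And>t. t \<in> K \<Longrightarrow> f t \<ge> 0"
  shows "positive_op (cont_fun_calc f A)"
  unfolding positive_op_def
proof (intro conjI self_adjoint_cont_fun_calc[OF f] allI)
  fix x
  define R where "R = cont_fun_calc (\<lambda>t. sqrt (f t)) A"
  have g: "continuous_on K (\<lambda>t. sqrt (f t))" by (intro continuous_intros f)
  have "cont_fun_calc f A = cont_fun_calc (\<lambda>t. sqrt (f t) * sqrt (f t)) A"
    by (rule cont_fun_calc_cong) (use nonneg in auto)
  then have "cont_fun_calc f A = R o\<^sub>L R" unfolding R_def by (simp only: cont_fun_calc_mult[OF g g])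
  moreover have "inner (R (R x)) x = inner (R x) (R x)"
    unfolding R_def by (rule self_adjointD[OF self_adjoint_cont_fun_calc[OF g]])
  ultimately show "0 \<le> inner (cont_fun_calc f A x) x" by simp
qed

lemma cont_fun_calc_eigenvector:
  assumes f: "continuous_on K f" and x: "A x = t *\<^sub>R x"
  shows "cont_fun_calc f A x = f t *\<^sub>R x"
proof (cases "x = 0")
  case False
  have "t \<in> real_spectrum A"
  proof (rule ccontr)
    assume "t \<notin> real_spectrum A"
    then obtain c where "c > 0" "c * norm x \<le> norm ((A - t *\<^sub>R id_blinfun) x)"
      using invertible_op_bounded_below unfolding real_spectrum_iff by metis
    then show False using x False by (simp add: blinfun.bilinear_simps mult_le_0_iff)
  qed
  obtain p where p: "uniform_limit K (\<lambda>k t. poly (p k) t) f sequentially"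
    "(\<lambda>k. poly_op (p k) A) \<longlonglongrightarrow> cont_fun_calc f A"
    using cont_fun_calc_sequence[OF f] by blast
  have "(\<lambda>k. poly_op (p k) A x) \<longlonglongrightarrow> cont_fun_calc f A x"
    by (intro tendsto_intros p)
  moreover have "(\<lambda>k. poly (p k) t *\<^sub>R x) \<longlonglongrightarrow> f t *\<^sub>R x"
    using K \<open>t \<in> _\<close> by (intro tendsto_intros tendsto_uniform_limitI[OF p(1)]) auto
  ultimately show ?thesis using LIMSEQ_unique by (simp add: poly_op_eigenvector[OF x])
qed (simp add: blinfun.bilinear_simps)

end

section \<open>Powers of positive operators\<close>

lemma spectrum_in_interval:
  "self_adjoint A \<Longrightarrow> spectrum_in A {- norm A..norm A}"
  by (simp add: spectrum_in_def real_spectrum_bounded)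

lemma spectrum_in_positive:
  "positive_op A \<Longrightarrow> spectrum_in A {0..norm A}"
  by (simp add: spectrum_in_def real_spectrum_positive positive_op_def)

lemma continuous_on_powr_nonneg:
  "r > 0 \<Longrightarrow> continuous_on {0..b} (\<lambda>t::real. t powr r)"
  by (rule continuous_on_powr') auto

lemma op_powr_0 [simp]: "op_powr A 0 = id_blinfun"
  by (simp add: op_powr_def)

lemma op_powr_1:
  assumes "positive_op A"
  shows "op_powr A 1 = A"
proof -
  interpret spectrum_in A "{0..norm A}" by (rule spectrum_in_positive[OF assms])
  have "cont_fun_calc (\<lambda>t. t powr 1) A = cont_fun_calc (poly [:0, 1:]) A"
    by (rule cont_fun_calc_cong) auto
  then show ?thesis by (simp add: op_powr_def cont_fun_calc_poly blinfun_eq_iff)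
qed

lemma op_powr_add:
  assumes A: "positive_op A" and r: "r \<ge> 0" and s: "s \<ge> 0"
  shows "op_powr A r o\<^sub>L op_powr A s = op_powr A (r + s)"
proof (cases "r = 0 \<or> s = 0")
  case False
  interpret spectrum_in A "{0..norm A}" by (rule spectrum_in_positive[OF A])
  have "cont_fun_calc (\<lambda>t. t powr r) A o\<^sub>L cont_fun_calc (\<lambda>t. t powr s) A
      = cont_fun_calc (\<lambda>t. t powr (r + s)) A"
    using False r s by (simp add: powr_add cont_fun_calc_mult continuous_on_powr_nonneg)
  then show ?thesis using False r s by (simp add: op_powr_def)
qed (auto simp: blinfun_eq_iff)

lemma op_power_op_powr:
  assumes A: "positive_op A" and r: "r \<ge> 0"
  shows "op_power (op_powr A r) n = op_powr A (n * r)"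
  by (induction n) (use assms in \<open>auto simp: op_powr_add algebra_simps\<close>)

lemma positive_op_powr:
  assumes A: "positive_op A" and r: "r \<ge> 0"
  shows "positive_op (op_powr A r)"
proof (cases "r = 0")
  case True
  then show ?thesis by (simp add: positive_op_def self_adjoint_id)
next
  case False
  interpret spectrum_in A "{0..norm A}" by (rule spectrum_in_positive[OF A])
  show ?thesis using False r
    by (simp add: op_powr_def positive_cont_fun_calc continuous_on_powr_nonneg)
qed

lemma op_powr_commute:
  assumes A: "positive_op A" and r: "r \<ge> 0" and C: "C o\<^sub>L A = A o\<^sub>L C"
  shows "C o\<^sub>L op_powr A r = op_powr A r o\<^sub>L C"
proof (cases "r = 0")
  case True
  then show ?thesis by (simp add: blinfun_eq_iff)
next
  case False
  interpret spectrum_in A "{0..norm A}" by (rule spectrum_in_positive[OF A])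
  show ?thesis using False r C
    by (simp add: op_powr_def cont_fun_calc_commute continuous_on_powr_nonneg)
qed

text \<open>For \<open>r \<le> 1\<close> the operator \<open>A\<close> is a multiple of \<open>A\<^sup>r\<close>; conversely \<open>A\<^sup>r\<close> acts on the kernel of
  \<open>A\<close> as \<open>0\<^sup>r = 0\<close>.\<close>

lemma op_powr_eq_0_iff:
  assumes A: "positive_op A" and r: "0 < r" "r \<le> 1"
  shows "op_powr A r x = 0 \<longleftrightarrow> A x = 0"
proof
  have "op_powr A (1 - r) o\<^sub>L op_powr A r = A"
    using op_powr_add[OF A, of "1 - r" r] r by (simp add: op_powr_1[OF A])
  then show "A x = 0" if "op_powr A r x = 0"
    using that by (metis blinfun.zero_right blinfun_apply_blinfun_compose)
next
  interpret spectrum_in A "{0..norm A}" by (rule spectrum_in_positive[OF A])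
  assume "A x = 0"
  then show "op_powr A r x = 0"
    using cont_fun_calc_eigenvector[of "\<lambda>t. t powr r" x 0] r
    by (simp add: op_powr_def continuous_on_powr_nonneg)
qed

section \<open>Modulus and polar decomposition\<close>

lemma positive_adj_compose:
  assumes "clinear_op T"
  shows "positive_op (adj T o\<^sub>L T)"
  unfolding positive_op_def self_adjoint_def
  by (metis blinfun_apply_blinfun_compose inner_adj[OF assms] inner_commute inner_ge_zero)

lemma clinear_op_compose: "clinear_op S \<Longrightarrow> clinear_op T \<Longrightarrow> clinear_op (S o\<^sub>L T)"
  by (simp add: clinear_op_def)

lemma clinear_op_power: "clinear_op T \<Longrightarrow> clinear_op (op_power T n)"
  by (induction n) (auto simp: clinear_op_compose, simp add: clinear_op_def)

lemma clinear_op_powr: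
  assumes "positive_op A" "clinear_op A" "r \<ge> 0"
  shows "clinear_op (op_powr A r)"
  using assms op_powr_commute[of A r imag_op] by (simp add: clinear_op_iff)

lemma positive_op_abs: "clinear_op T \<Longrightarrow> positive_op (op_abs T)"
  by (simp add: op_abs_def positive_op_powr positive_adj_compose)

lemma clinear_op_abs: "clinear_op T \<Longrightarrow> clinear_op (op_abs T)"
  by (simp add: op_abs_def clinear_op_powr positive_adj_compose clinear_op_compose clinear_adj)

lemma op_abs_square:
  assumes "clinear_op T"
  shows "op_abs T o\<^sub>L op_abs T = adj T o\<^sub>L T"
  using assms by (simp add: op_abs_def op_powr_add op_powr_1 positive_adj_compose)

lemma norm_op_abs:
  assumes "clinear_op T"
  shows "norm (op_abs T x) = norm (T x)"
proof -
  have sa: "self_adjoint (op_abs T)" using positive_op_abs[OF assms] by (simp add: positive_op_def)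
  have "op_abs T (op_abs T x) = adj T (T x)"
    using op_abs_square[OF assms] by (metis blinfun_apply_blinfun_compose)
  then have "inner (op_abs T x) (op_abs T x) = inner (T x) (T x)"
    by (simp add: self_adjointD[OF sa] inner_adj[OF assms])
  then show ?thesis by (simp add: norm_eq_sqrt_inner)
qed

lemma op_abs_commute:
  assumes "clinear_op T" "C o\<^sub>L (adj T o\<^sub>L T) = (adj T o\<^sub>L T) o\<^sub>L C"
  shows "C o\<^sub>L op_abs T = op_abs T o\<^sub>L C"
  unfolding op_abs_def by (rule op_powr_commute) (use assms positive_adj_compose in auto)

lemma subspace_closure:
  fixes M :: "'a::real_normed_vector set"
  assumes "subspace M"
  shows "subspace (closure M)"
  unfolding subspace_def
proof (intro conjI ballI allI)
  show "0 \<in> closure M" using assms closure_subset subspace_0 by blast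
next
  fix x y assume "x \<in> closure M" "y \<in> closure M"
  then obtain u v where "\<And>k. u k \<in> M" "u \<longlonglongrightarrow> x" "\<And>k. v k \<in> M" "v \<longlonglongrightarrow> y"
    unfolding closure_sequential by blast
  then show "x + y \<in> closure M" unfolding closure_sequential
    by (intro exI[of _ "\<lambda>k. u k + v k"]) (simp add: assms subspace_add tendsto_add)
next
  fix c x assume "x \<in> closure M"
  then obtain u where "\<And>k. u k \<in> M" "u \<longlonglongrightarrow> x"
    unfolding closure_sequential by blast
  then show "c *\<^sub>R x \<in> closure M" unfolding closure_sequential
    by (intro exI[of _ "\<lambda>k. c *\<^sub>R u k"]) (simp add: assms subspace_scale tendsto_scaleR)
qed

text \<open>The orthogonal complement of the range of a self-adjoint operator is its kernel.\<close>

lemma closure_range_decomposition: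
  fixes L :: "'a::{real_inner,complete_space} \<Rightarrow>\<^sub>L 'a"
  assumes L: "self_adjoint L"
  obtains p where "p \<in> closure (range L)" "L (x - p) = 0"
proof -
  obtain p where p: "p \<in> closure (range L)"
    "\<And>y. y \<in> closure (range L) \<Longrightarrow> inner (x - p) y = 0"
    using orthogonal_decomposition[of "closure (range L)" x] subspace_range[THEN subspace_closure]
    by auto
  have "L z \<in> closure (range L)" for z by (rule subsetD[OF closure_subset]) simp
  then have "inner (L (x - p)) z = 0" for z
    using p(2) by (simp add: self_adjointD[OF L])
  then have "L (x - p) = 0" by (metis inner_eq_zero_iff)
  then show thesis using that p(1) by blast
qed

lemma orthogonal_closure_range_kernel:
  assumes L: "self_adjoint L" and p: "p \<in> closure (range L)" and x: "L x = 0"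
  shows "inner p x = 0"
proof -
  have "range L \<subseteq> {q. inner q x = 0}" using x by (auto simp: self_adjointD[OF L])
  moreover have "closed {q. inner q x = 0}"
    by (intro closed_Collect_eq continuous_intros)
  ultimately show ?thesis using p closure_minimal by blast
qed

lemma blinfun_eq_on_range_and_kernel:
  fixes X Y L :: "'a::{real_inner,complete_space} \<Rightarrow>\<^sub>L 'a"
  assumes L: "self_adjoint L" and range: "X o\<^sub>L L = Y o\<^sub>L L"
    and ker: "\<And>x. L x = 0 \<Longrightarrow> X x = Y x"
  shows "X = Y"
proof (rule blinfun_eqI)
  fix x
  obtain p where p: "p \<in> closure (range L)" "L (x - p) = 0"
    using closure_range_decomposition[OF L] by blast
  have "range L \<subseteq> {q. X q = Y q}" using range by (auto simp: blinfun_eq_iff)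
  moreover have "closed {q. X q = Y q}"
    by (intro closed_Collect_eq continuous_intros)
  ultimately have "X p = Y p" using p(1) closure_minimal by blast
  moreover have "X (x - p) = Y (x - p)" by (rule ker[OF p(2)])
  ultimately show "X x = Y x" by (simp add: blinfun.diff_right)
qed

text \<open>On the closure of the range of \<open>|T|\<close> the map \<open>|T|x \<mapsto> Tx\<close> extends by continuity; on the
  orthogonal complement, which is the kernel of \<open>|T|\<close>, the partial isometry is zero.  Below,
  \<open>R\<close> is the graph of the extension, and \<open>G\<close> that of the partial isometry: \<open>G x u\<close> says that \<open>u\<close> is
  the image of the component of \<open>x\<close> in the closure of the range of \<open>|T|\<close>.\<close>

lemma polar_decomposition_exists:
  fixes T :: "'a::chilbert_space \<Rightarrow>\<^sub>L 'a"
  assumes T: "clinear_op T"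
  obtains U where "partial_isometry U" "T = U o\<^sub>L op_abs T" "{x. U x = 0} = {x. op_abs T x = 0}"
proof -
  define H where "H = op_abs T"
  have H: "self_adjoint H" "clinear_op H"
    using positive_op_abs[OF T] clinear_op_abs[OF T] by (auto simp: H_def positive_op_def)
  have nH: "norm (H x) = norm (T x)" for x unfolding H_def by (rule norm_op_abs[OF T])
  define R where "R p u \<longleftrightarrow> (\<exists>z. (\<lambda>k::nat. H (z k)) \<longlonglongrightarrow> p \<and> (\<lambda>k. T (z k)) \<longlonglongrightarrow> u)" for p u
  have R_add: "R (p + q) (u + v)" if "R p u" "R q v" for p q u v
  proof -
    obtain y z :: "nat \<Rightarrow> 'a" where "(\<lambda>k. H (y k)) \<longlonglongrightarrow> p" "(\<lambda>k. T (y k)) \<longlonglongrightarrow> u"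
      "(\<lambda>k. H (z k)) \<longlonglongrightarrow> q" "(\<lambda>k. T (z k)) \<longlonglongrightarrow> v"
      using \<open>R p u\<close> \<open>R q v\<close> unfolding R_def by blast
    then show ?thesis unfolding R_def
      by (intro exI[of _ "\<lambda>k. y k + z k"]) (simp add: blinfun.add_right tendsto_add)
  qed
  have R_commute: "R (J p) (J u)" if "R p u" "J o\<^sub>L H = H o\<^sub>L J" "J o\<^sub>L T = T o\<^sub>L J" for p u and J :: "'a \<Rightarrow>\<^sub>L 'a"
  proof -
    obtain z :: "nat \<Rightarrow> 'a" where z: "(\<lambda>k. H (z k)) \<longlonglongrightarrow> p" "(\<lambda>k. T (z k)) \<longlonglongrightarrow> u"
      using \<open>R p u\<close> unfolding R_def by blast
    have "(\<lambda>k. J (H (z k))) \<longlonglongrightarrow> J p" "(\<lambda>k. J (T (z k))) \<longlonglongrightarrow> J u"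
      by (intro tendsto_intros z)+
    then show ?thesis using that(2,3) unfolding R_def
      by (intro exI[of _ "\<lambda>k. J (z k)"]) (simp add: blinfun_eq_iff)
  qed
  have R_scale: "R (r *\<^sub>R p) (r *\<^sub>R u)" if "R p u" for r p u
    using R_commute[OF that, of "r *\<^sub>R id_blinfun"]
    by (simp add: blinfun_eq_iff blinfun.bilinear_simps)
  have R_diff: "R (p - q) (u - v)" if "R p u" "R q v" for p q u v
    using R_add[OF that(1) R_scale[OF that(2), of "-1"]] by simp
  have R_i: "R (imag_op p) (imag_op u)" if "R p u" for p u
    using R_commute[OF that] T H(2) by (simp add: clinear_op_iff)
  have R_norm: "norm u = norm p" if pu: "R p u" for p u
  proof -
    obtain z :: "nat \<Rightarrow> 'a" where z: "(\<lambda>k. H (z k)) \<longlonglongrightarrow> p" "(\<lambda>k. T (z k)) \<longlonglongrightarrow> u"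
      using pu unfolding R_def by blast
    then have "(\<lambda>k. norm (T (z k))) \<longlonglongrightarrow> norm p" "(\<lambda>k. norm (T (z k))) \<longlonglongrightarrow> norm u"
      using tendsto_norm[OF z(1)] tendsto_norm[OF z(2)] by (simp_all add: nH)
    then show ?thesis using LIMSEQ_unique by blast
  qed
  have R_ex: "\<exists>u. R p u" if pcl: "p \<in> closure (range H)" for p
  proof -
    obtain w where w: "\<And>k. w k \<in> range H" "w \<longlonglongrightarrow> p"
      using pcl unfolding closure_sequential by blast
    then have "\<forall>k. \<exists>z. w k = H z" by blast
    then obtain z where z: "\<And>k. w k = H (z k)" by metis
    have "Cauchy (\<lambda>k. T (z k))"
    proof (rule CauchyI)
      fix e :: real assume "e > 0"
      then obtain N where N: "\<And>m k. m \<ge> N \<Longrightarrow> k \<ge> N \<Longrightarrow> norm (w m - w k) < e"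
        using CauchyD[OF LIMSEQ_imp_Cauchy[OF w(2)]] by blast
      have "norm (T (z m) - T (z k)) = norm (w m - w k)" for m k
        using nH[of "z m - z k"] by (simp add: z blinfun.diff_right)
      then show "\<exists>N. \<forall>m\<ge>N. \<forall>k\<ge>N. norm (T (z m) - T (z k)) < e" using N by metis
    qed
    then obtain u where "(\<lambda>k. T (z k)) \<longlonglongrightarrow> u" using Cauchy_convergent convergentD by blast
    moreover have "(\<lambda>k. H (z k)) \<longlonglongrightarrow> p" using w(2) by (simp add: z[symmetric])
    ultimately show ?thesis unfolding R_def by blast
  qed
  have R_closure: "p \<in> closure (range H)" if pu: "R p u" for p u
  proof -
    obtain z :: "nat \<Rightarrow> 'a" where "(\<lambda>k. H (z k)) \<longlonglongrightarrow> p" using pu unfolding R_def by blast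
    then show ?thesis unfolding closure_sequential by (intro exI[of _ "\<lambda>k. H (z k)"]) simp
  qed
  define G where "G x u \<longleftrightarrow> (\<exists>p. R p u \<and> H (x - p) = 0)" for x u
  have G_ex: "\<exists>u. G x u" for x
  proof -
    obtain p where "p \<in> closure (range H)" "H (x - p) = 0"
      by (rule closure_range_decomposition[OF H(1)])
    then show ?thesis using R_ex unfolding G_def by blast
  qed
  have G_norm: "norm u \<le> norm x" if xu: "G x u" for x u
  proof -
    obtain p where p: "R p u" "H (x - p) = 0" using xu unfolding G_def by blast
    have "inner p (x - p) = 0"
      by (rule orthogonal_closure_range_kernel[OF H(1) R_closure[OF p(1)] p(2)])
    then have "(norm x)\<^sup>2 = (norm p)\<^sup>2 + (norm (x - p))\<^sup>2"
      using norm_add_Pythagorean[of p "x - p"] by (simp add: orthogonal_def)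
    then have "norm p \<le> norm x" by (metis le_add_same_cancel1 norm_ge_zero power2_le_imp_le zero_le_power2)
    then show ?thesis using R_norm[OF p(1)] by simp
  qed
  have G_add: "G (x + y) (u + v)" if xy: "G x u" "G y v" for x y u v
  proof -
    obtain p q where "R p u" "H (x - p) = 0" "R q v" "H (y - q) = 0"
      using xy unfolding G_def by blast
    then show ?thesis unfolding G_def
      by (intro exI[of _ "p + q"]) (simp add: R_add blinfun.bilinear_simps algebra_simps)
  qed
  have G_scale: "G (r *\<^sub>R x) (r *\<^sub>R u)" if xu: "G x u" for r x u
  proof -
    obtain p where "R p u" "H (x - p) = 0" using xu unfolding G_def by blast
    then show ?thesis unfolding G_def
      by (intro exI[of _ "r *\<^sub>R p"]) (simp add: R_scale blinfun.bilinear_simps)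
  qed
  have G_i: "G (imag_op x) (imag_op u)" if xu: "G x u" for x u
  proof -
    obtain p where p: "R p u" "H (x - p) = 0" using xu unfolding G_def by blast
    have "H (imag_op (x - p)) = imag_op (H (x - p))"
      using H(2) unfolding clinear_op_iff blinfun_eq_iff by simp
    then have "H (imag_op x - imag_op p) = 0" using p(2) by (simp add: blinfun.bilinear_simps)
    then show ?thesis unfolding G_def using R_i[OF p(1)] by blast
  qed
  have G_fun: "u = v" if uv: "G x u" "G x v" for x u v
  proof -
    have "G (x + (-1) *\<^sub>R x) (u + (-1) *\<^sub>R v)" by (intro G_add G_scale uv)
    then show ?thesis using G_norm by fastforce
  qed
  obtain g where g: "\<And>x. G x (g x)" using G_ex by metis
  have bl: "bounded_linear g"
  proof (rule bounded_linear_intro[where K = 1])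
    show "g (x + y) = g x + g y" for x y by (rule G_fun[OF g G_add[OF g g]])
    show "g (r *\<^sub>R x) = r *\<^sub>R g x" for r x by (rule G_fun[OF g G_scale[OF g]])
    show "norm (g x) \<le> norm x * 1" for x using G_norm[OF g] by simp
  qed
  define U where "U = Blinfun g"
  have U: "G x (U x)" for x unfolding U_def using g bl by (simp add: bounded_linear_Blinfun_apply)
  have clin: "clinear_op U"
    unfolding clinear_op_iff by (rule blinfun_eqI) (simp add: G_fun[OF U G_i[OF U]])
  have UH: "T = U o\<^sub>L H"
  proof (rule blinfun_eqI)
    fix x
    have "R (H x) (T x)" unfolding R_def by (intro exI[of _ "\<lambda>k. x"]) simp
    then have "G (H x) (T x)" unfolding G_def by (intro exI[of _ "H x"]) simp
    then show "T x = (U o\<^sub>L H) x" using G_fun[OF U] by simp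
  qed
  have ker: "U x = 0 \<longleftrightarrow> H x = 0" for x
  proof
    assume "H x = 0"
    moreover have "R 0 0" unfolding R_def by (intro exI[of _ "\<lambda>k. 0"]) simp
    ultimately have "G x 0" unfolding G_def by (intro exI[of _ 0]) simp
    then show "U x = 0" using G_fun[OF U] by blast
  next
    assume "U x = 0"
    then obtain p where p: "R p 0" "H (x - p) = 0" using U[of x] by (auto simp: G_def)
    then have "p = 0" using R_norm[OF p(1)] by simp
    then show "H x = 0" using p(2) by simp
  qed
  have "partial_isometry U"
    unfolding partial_isometry_def
  proof (intro conjI clin allI impI)
    fix x assume x: "\<forall>y. U y = 0 \<longrightarrow> cinner x y = 0"
    obtain p where p: "R p (U x)" "H (x - p) = 0" using U[of x] by (auto simp: G_def)
    then have "cinner x (x - p) = 0" using x ker by blast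
    then have "inner x (x - p) = 0" by (simp add: inner_eq_Re_cinner)
    moreover have "inner p (x - p) = 0"
      by (rule orthogonal_closure_range_kernel[OF H(1) R_closure[OF p(1)] p(2)])
    ultimately have "inner (x - p) (x - p) = 0" by (simp add: inner_diff_left)
    then have "x = p" by simp
    then show "norm (U x) = norm x" using R_norm[OF p(1)] by simp
  qed
  then show thesis using that UH ker unfolding H_def by blast
qed

lemma polar_isometry:
  assumes T: "clinear_op T"
  shows polar_isometry_compose: "polar_isometry T o\<^sub>L op_abs T = T"
    and polar_isometry_kernel: "polar_isometry T x = 0 \<longleftrightarrow> op_abs T x = 0"
proof -
  obtain U where U: "partial_isometry U" "T = U o\<^sub>L op_abs T" "{x. U x = 0} = {x. op_abs T x = 0}"
    using polar_decomposition_exists[OF T] by blast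
  have "polar_isometry T = U"
    unfolding polar_isometry_def
  proof (rule the_equality)
    fix V assume V: "partial_isometry V \<and> T = V o\<^sub>L op_abs T \<and> {x. V x = 0} = {x. op_abs T x = 0}"
    show "V = U"
    proof (rule blinfun_eq_on_range_and_kernel)
      show "self_adjoint (op_abs T)" using positive_op_abs[OF T] by (simp add: positive_op_def)
      show "V o\<^sub>L op_abs T = U o\<^sub>L op_abs T" using U(2) V by metis
      show "V x = U x" if "op_abs T x = 0" for x
      proof -
        have "V x = 0" "U x = 0" using that U(3) V by blast+
        then show ?thesis by simp
      qed
    qed
  qed (use U in blast)
  then show "polar_isometry T o\<^sub>L op_abs T = T" "polar_isometry T x = 0 \<longleftrightarrow> op_abs T x = 0"
    using U by auto
qed

section \<open>The Aluthge transform\<close>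

text \<open>With \<open>L = |T|\<^sup>l\<close> one has \<open>\<Delta>\<^sub>l(T) L = L T\<close>, hence \<open>\<Delta>\<^sub>l(T)\<^sup>n L = L T\<^sup>n = T\<^sup>n L\<close> if \<open>T\<^sup>n\<close> commutes
  with \<open>|T|\<close>; moreover both operators vanish on the kernel of \<open>L\<close>.\<close>

lemma aluthge_power:
  assumes T: "clinear_op T" and l: "0 < l" "l \<le> 1" and n: "n \<ge> 1"
    and comm: "op_power T n o\<^sub>L (adj T o\<^sub>L T) = (adj T o\<^sub>L T) o\<^sub>L op_power T n"
  shows "op_power (aluthge l T) n = op_power T n"
proof -
  define H U where "H = op_abs T" and "U = polar_isometry T"
  define L M where "L = op_powr H l" and "M = op_powr H (1 - l)"
  have H: "positive_op H" unfolding H_def by (rule positive_op_abs[OF T])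
  have L: "self_adjoint L" using positive_op_powr[OF H, of l] l by (simp add: L_def positive_op_def)
  have al: "aluthge l T x = L (U (M x))" for x
    by (simp add: aluthge_def L_def M_def H_def U_def)
  have M_L: "M (L x) = H x" for x
    using op_powr_add[OF H, of "1 - l" l] l
    by (simp add: L_def M_def op_powr_1[OF H] blinfun_eq_iff)
  have UH: "U (H x) = T x" for x
    using polar_isometry_compose[OF T] by (simp add: U_def H_def blinfun_eq_iff)
  have step: "aluthge l T (L x) = L (T x)" for x by (simp add: al M_L UH)
  have pow: "op_power (aluthge l T) k (L x) = L (op_power T k x)" for k x
    by (induction k) (auto simp: step)
  have "op_power T n o\<^sub>L L = L o\<^sub>L op_power T n"
    unfolding L_def H_def
    by (intro op_powr_commute op_abs_commute positive_op_abs T comm) (use l in simp)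
  then have range: "op_power (aluthge l T) n o\<^sub>L L = op_power T n o\<^sub>L L"
    by (simp add: blinfun_eq_iff pow)
  have ker: "op_power (aluthge l T) n x = op_power T n x" if x: "L x = 0" for x
  proof -
    have Hx: "H x = 0" using x op_powr_eq_0_iff[OF H l] by (simp add: L_def)
    \<comment> \<open>For \<open>l = 1\<close> the factor \<open>M = |T|\<^sup>0\<close> is the identity, and it is \<open>U\<close> that annihilates \<open>x\<close>.\<close>
    have "U (M x) = 0"
    proof (cases "l = 1")
      case True
      then have "M x = x" by (simp add: M_def)
      then show ?thesis using Hx polar_isometry_kernel[OF T] by (simp add: U_def H_def)
    next
      case False
      then have "M x = 0" using Hx op_powr_eq_0_iff[OF H, of "1 - l" x] l by (simp add: M_def)
      then show ?thesis by (simp add: blinfun.zero_right)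
    qed
    then have "aluthge l T x = 0" by (simp add: al blinfun.zero_right)
    moreover have "T x = 0" using UH[of x] Hx by (simp add: blinfun.zero_right)
    moreover have "op_power S n x = 0" if "S x = 0" for S :: "'a \<Rightarrow>\<^sub>L 'a"
    proof -
      obtain m where "n = m + 1" using n by (metis add.commute le_Suc_ex)
      then show ?thesis using that by (simp only: op_power_add) (simp add: blinfun.zero_right)
    qed
    ultimately show ?thesis by simp
  qed
  show ?thesis by (rule blinfun_eq_on_range_and_kernel[OF L range ker])
qed

lemma aluthge_quasinormal:
  assumes T: "clinear_op T" and l: "0 < l" "l \<le> 1" and q: "quasinormal T"
  shows "aluthge l T = T"
proof -
  have id: "op_power S (Suc 0) = S" for S :: "'a::chilbert_space \<Rightarrow>\<^sub>L 'a" by (simp add: blinfun_eq_iff)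
  have "op_power (aluthge l T) (Suc 0) = op_power T (Suc 0)"
    by (rule aluthge_power[OF T l]) (use q in \<open>simp_all add: id quasinormal_def commutator_def del: op_power.simps\<close>)
  then show ?thesis by (simp only: id)
qed

section \<open>Approximate eigenvectors of commuting operators\<close>

lemma self_adjoint_eq_0:
  assumes D: "self_adjoint D" and 0: "\<And>x. inner (D x) x = 0"
  shows "D = 0"
proof (rule blinfun_eqI)
  fix x
  have "inner (D (D x)) x = inner (D x) (D x)" by (rule self_adjointD[OF D])
  then have "inner (D x) (D x) = 0"
    using 0[of "x + D x"] 0[of x] 0[of "D x"]
    by (simp add: blinfun.add_right inner_add_left inner_add_right)
  then show "D x = (0 :: 'a \<Rightarrow>\<^sub>L 'a) x" by simp
qed

text \<open>The range of \<open>P = (D - e)\<^sup>+\<close> replaces the spectral subspace on which \<open>D \<ge> e\<close>.  With \<open>f\<close> and \<open>g\<close>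
  the positive and negative parts of \<open>t - e\<close> one has \<open>D - e = P - g(D)\<close>, so \<open>P = 0\<close> would give
  \<open>D \<le> e\<close>; and \<open>(t - e) f(t) = f(t)\<^sup>2\<close> gives \<open>(D - e) P = P\<^sup>2\<close>.\<close>

lemma positive_part_exists:
  fixes D :: "'a::chilbert_space \<Rightarrow>\<^sub>L 'a"
  assumes D: "self_adjoint D" and x: "inner (D x) x > 0"
  obtains e P where "e > 0" "P \<noteq> 0" "\<forall>C. C o\<^sub>L D = D o\<^sub>L C \<longrightarrow> C o\<^sub>L P = P o\<^sub>L C"
    "\<forall>y. e * (norm (P y))\<^sup>2 \<le> inner (D (P y)) (P y)"
proof -
  interpret spectrum_in D "{- norm D..norm D}" by (rule spectrum_in_interval[OF D])
  have nx: "norm x > 0" using x by (auto simp: blinfun.zero_right)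
  define e where "e = inner (D x) x / (2 * (norm x)\<^sup>2)"
  define f g where "f = (\<lambda>t::real. max (t - e) 0)" and "g = (\<lambda>t::real. max (e - t) 0)"
  have c: "continuous_on S f" "continuous_on S g" for S
    unfolding f_def g_def by (intro continuous_intros)+
  define P where "P = cont_fun_calc f D"
  have lin: "cont_fun_calc (poly [:- e, 1:]) D y = D y - e *\<^sub>R y" for y
    by (simp add: cont_fun_calc_poly blinfun.bilinear_simps)
  have "e > 0" using x nx by (simp add: e_def)
  moreover have "P \<noteq> 0"
  proof
    assume "P = 0"
    have "P = cont_fun_calc (\<lambda>t. poly [:- e, 1:] t + g t) D"
      unfolding P_def by (rule cont_fun_calc_cong) (simp add: f_def g_def max_def)
    also have "\<dots> = cont_fun_calc (poly [:- e, 1:]) D + cont_fun_calc g D"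
      by (rule cont_fun_calc_add) (intro continuous_intros c)+
    finally have "D x - e *\<^sub>R x + cont_fun_calc g D x = 0"
      using \<open>P = 0\<close> lin by (metis blinfun.add_left blinfun.zero_left)
    then have "inner (D x - e *\<^sub>R x + cont_fun_calc g D x) x = 0" by simp
    then have "inner (D x) x - e * (norm x)\<^sup>2 + inner (cont_fun_calc g D x) x = 0"
      by (simp add: inner_add_left inner_diff_left power2_norm_eq_inner)
    moreover have "inner (cont_fun_calc g D x) x \<ge> 0"
      using positive_cont_fun_calc[OF c(2)] by (simp add: positive_op_def g_def)
    moreover have "e * (norm x)\<^sup>2 = inner (D x) x / 2" using nx by (simp add: e_def)
    ultimately show False using x by linarith
  qed
  moreover have "C o\<^sub>L P = P o\<^sub>L C" if "C o\<^sub>L D = D o\<^sub>L C" for C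
    unfolding P_def by (rule cont_fun_calc_commute[OF c(1) that])
  moreover have "e * (norm (P y))\<^sup>2 \<le> inner (D (P y)) (P y)" for y
  proof -
    have "cont_fun_calc (poly [:- e, 1:]) D o\<^sub>L P = cont_fun_calc (\<lambda>t. poly [:- e, 1:] t * f t) D"
      unfolding P_def by (rule cont_fun_calc_mult[symmetric]) (intro continuous_intros c)+
    also have "\<dots> = cont_fun_calc (\<lambda>t. f t * f t) D"
      by (rule cont_fun_calc_cong) (simp add: f_def max_def)
    also have "\<dots> = P o\<^sub>L P" unfolding P_def by (rule cont_fun_calc_mult[OF c(1) c(1)])
    finally have "D (P y) - e *\<^sub>R P y = P (P y)" by (metis blinfun_apply_blinfun_compose lin)
    moreover have "inner (P (P y)) (P y) \<ge> 0"
      using positive_cont_fun_calc[OF c(1)] by (simp add: positive_op_def P_def f_def)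
    ultimately have "inner (D (P y) - e *\<^sub>R P y) (P y) \<ge> 0" by simp
    then show ?thesis by (simp add: inner_diff_left power2_norm_eq_inner)
  qed
  ultimately show thesis using that by blast
qed

text \<open>The supremum of the numerical range of a self-adjoint operator on an invariant subspace is
  an approximate eigenvalue.\<close>

lemma approximate_eigenvector:
  fixes B :: "'a::real_inner \<Rightarrow>\<^sub>L 'a"
  assumes B: "self_adjoint B" and M: "subspace M" and inv: "\<And>x. x \<in> M \<Longrightarrow> B x \<in> M"
    and ne: "z \<in> M" "z \<noteq> 0"
  obtains s y where "\<forall>k::nat. y k \<in> M" "\<forall>k. norm (y k) = 1" "(\<lambda>k. B (y k) - s *\<^sub>R y k) \<longlonglongrightarrow> 0"
proof -
  define S where "S = {inner (B x) x | x. x \<in> M \<and> norm x = 1}"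
  define s where "s = Sup S"
  define C where "C = \<bar>s\<bar> + norm B + 1"
  have C: "C > 0" unfolding C_def by (smt (verit) norm_ge_zero)
  have "inner (B x) x \<le> norm B" if "norm x = 1" for x
    using abs_inner_blinfun_le[of B x] that by auto
  then have bdd: "bdd_above S" unfolding S_def by (intro bdd_aboveI[of _ "norm B"]) auto
  have "(1 / norm z) *\<^sub>R z \<in> M" using ne M by (simp add: subspace_scale)
  then have "inner (B ((1 / norm z) *\<^sub>R z)) ((1 / norm z) *\<^sub>R z) \<in> S"
    using ne unfolding S_def by fastforce
  then have neS: "S \<noteq> {}" by blast
  have upper: "inner (B x) x \<le> s * (norm x)\<^sup>2" if x: "x \<in> M" for x
  proof (cases "x = 0")
    case False
    define u where "u = (1 / norm x) *\<^sub>R x"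
    have "u \<in> M" "norm u = 1" using x M False by (auto simp: u_def subspace_scale)
    then have "inner (B u) u \<le> s" unfolding s_def by (intro cSup_upper bdd) (auto simp: S_def)
    then show ?thesis using False
      by (simp add: u_def blinfun.scaleR_right field_simps power2_eq_square)
  qed (simp add: blinfun.zero_right)
  have "\<exists>y. y \<in> M \<and> norm y = 1 \<and> norm (B y - s *\<^sub>R y) < e" if e: "e > 0" for e
  proof -
    have "s - e\<^sup>2 / C < Sup S" using e C by (simp add: s_def)
    then obtain y where y: "y \<in> M" "norm y = 1" "s - e\<^sup>2 / C < inner (B y) y"
      using less_cSup_iff[OF neS bdd] unfolding S_def by auto
    \<comment> \<open>The form \<open>\<langle>(s - B)u, u\<rangle>\<close> is nonnegative on \<open>M\<close> and bounded by \<open>C \<parallel>u\<parallel>\<^sup>2\<close>; evaluating it at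
      \<open>y - (1/C) v\<close> bounds \<open>\<parallel>v\<parallel>\<^sup>2\<close> by \<open>C\<close> times its value at \<open>y\<close>.\<close>
    define v where "v = s *\<^sub>R y - B y"
    have v: "v \<in> M" unfolding v_def by (intro subspace_diff[OF M] subspace_scale[OF M] inv y)
    have yM: "y - (1 / C) *\<^sub>R v \<in> M" by (intro subspace_diff[OF M] subspace_scale[OF M] v y)
    have vB: "inner v (B y) = s * inner v y - inner v v"
      by (simp add: v_def inner_diff_left inner_diff_right)
    have yB: "inner y (B v) = s * inner v y - inner v v"
      using vB self_adjointD[OF B, of v y] by (simp add: inner_commute)
    have "s * inner (y - r *\<^sub>R v) (y - r *\<^sub>R v) - inner (B (y - r *\<^sub>R v)) (y - r *\<^sub>R v)
        = (s * inner y y - inner (B y) y) - 2 * r * inner v v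
          + r\<^sup>2 * (s * inner v v - inner (B v) v)" for r
      by (simp add: blinfun.bilinear_simps inner_diff_left inner_diff_right inner_commute
          power2_eq_square vB yB algebra_simps)
    note this[of "1 / C"]
    moreover have "s * inner v v - inner (B v) v \<le> C * inner v v"
    proof -
      have "s * inner v v \<le> \<bar>s\<bar> * inner v v" by (intro mult_right_mono) auto
      moreover have "C * inner v v = \<bar>s\<bar> * inner v v + norm B * inner v v + inner v v"
        by (simp add: C_def algebra_simps)
      ultimately show ?thesis
        using abs_inner_blinfun_le[of B v] inner_ge_zero[of v]
        unfolding power2_norm_eq_inner by linarith
    qed
    then have "(1 / C)\<^sup>2 * (s * inner v v - inner (B v) v) \<le> (1 / C)\<^sup>2 * (C * inner v v)"
      by (rule mult_left_mono) simp
    then have "(1 / C)\<^sup>2 * (s * inner v v - inner (B v) v) \<le> 1 / C * inner v v"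
      using C by (simp add: power2_eq_square)
    moreover have "s * inner y y - inner (B y) y < e\<^sup>2 / C"
      using y by (simp add: power2_norm_eq_inner[symmetric])
    ultimately have "1 / C * inner v v < e\<^sup>2 / C"
      using upper[OF yM] unfolding power2_norm_eq_inner by linarith
    then have "(norm v)\<^sup>2 < e\<^sup>2" using C by (simp add: power2_norm_eq_inner divide_less_cancel)
    then have "norm v < e" using e by (simp add: power2_less_imp_less)
    then show ?thesis using y by (auto simp: v_def norm_minus_commute)
  qed
  then have "\<forall>k::nat. \<exists>y. y \<in> M \<and> norm y = 1 \<and> norm (B y - s *\<^sub>R y) < inverse (real (Suc k))" by simp
  then obtain y where y: "\<And>k::nat. y k \<in> M" "\<And>k. norm (y k) = 1"
    "\<And>k. norm (B (y k) - s *\<^sub>R y k) < inverse (real (Suc k))"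
    by meson
  have "(\<lambda>k. B (y k) - s *\<^sub>R y k) \<longlonglongrightarrow> 0"
    by (rule Lim_null_comparison[OF _ LIMSEQ_inverse_real_of_nat]) (intro always_eventually allI less_imp_le y(3))
  then show thesis using that y by blast
qed

lemma approximate_eigenvector_powers:
  fixes B :: "'a::real_inner \<Rightarrow>\<^sub>L 'a"
  assumes y: "\<And>k::nat. norm (y k) = 1" and lim: "(\<lambda>k. B (y k) - s *\<^sub>R y k) \<longlonglongrightarrow> 0"
  shows "(\<lambda>k. inner (op_power B j (y k)) (y k)) \<longlonglongrightarrow> s ^ j"
proof -
  have *: "(\<lambda>k. op_power B j (y k) - s ^ j *\<^sub>R y k) \<longlonglongrightarrow> 0"
  proof (induction j)
    case (Suc j)
    have "(\<lambda>k. B (op_power B j (y k) - s ^ j *\<^sub>R y k) + s ^ j *\<^sub>R (B (y k) - s *\<^sub>R y k))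
        \<longlonglongrightarrow> B 0 + s ^ j *\<^sub>R 0"
      by (intro tendsto_intros Suc lim)
    then show ?case by (simp add: blinfun.bilinear_simps algebra_simps)
  qed simp
  have "(\<lambda>k. inner (op_power B j (y k) - s ^ j *\<^sub>R y k) (y k)) \<longlonglongrightarrow> 0"
  proof (rule Lim_null_comparison[OF _ tendsto_norm_zero[OF *]], intro always_eventually allI)
    fix k show "norm (inner (op_power B j (y k) - s ^ j *\<^sub>R y k) (y k))
        \<le> norm (op_power B j (y k) - s ^ j *\<^sub>R y k)"
      using Cauchy_Schwarz_ineq2[of _ "y k"] y[of k] by simp
  qed
  from tendsto_add[OF this tendsto_const[of "s ^ j"]] show ?thesis
    by (simp add: inner_diff_left power2_norm_eq_inner[symmetric] y)
qed

text \<open>If \<open>D\<close> and \<open>B\<close> commute and \<open>D \<le> 0\<close> fails, then \<open>B\<close> has approximate eigenvectors inside a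
  subspace on which \<open>D\<close> is bounded below by a positive constant.\<close>

lemma joint_approximate_eigenvector:
  fixes B D :: "'a::chilbert_space \<Rightarrow>\<^sub>L 'a"
  assumes D: "self_adjoint D" and B: "self_adjoint B" and comm: "B o\<^sub>L D = D o\<^sub>L B"
    and x: "inner (D x) x > 0"
  obtains e s y where "e > 0" "\<And>k::nat. norm (y k) = 1" "\<And>k. e \<le> inner (D (y k)) (y k)"
    "\<And>j. (\<lambda>k. inner (op_power B j (y k)) (y k)) \<longlonglongrightarrow> s ^ j"
proof -
  obtain e P where P: "e > 0" "P \<noteq> 0" "\<forall>C. C o\<^sub>L D = D o\<^sub>L C \<longrightarrow> C o\<^sub>L P = P o\<^sub>L C"
    "\<forall>y. e * (norm (P y))\<^sup>2 \<le> inner (D (P y)) (P y)"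
    using positive_part_exists[OF D x] by blast
  have BP: "B (P y) = P (B y)" for y using P(3) comm by (simp add: blinfun_eq_iff)
  obtain z where z: "P z \<noteq> 0" using P(2) by (auto simp: blinfun_eq_iff)
  have inv: "B y \<in> range P" if "y \<in> range P" for y
    using that by (auto simp: BP)
  obtain s y where y: "\<forall>k::nat. y k \<in> range P" "\<forall>k. norm (y k) = 1"
    "(\<lambda>k. B (y k) - s *\<^sub>R y k) \<longlonglongrightarrow> 0"
    by (rule approximate_eigenvector[OF B subspace_range[of P] inv rangeI z])
  have "e \<le> inner (D (y k)) (y k)" for k
  proof -
    obtain w where w: "y k = P w" using y(1) by blast
    show ?thesis using P(4)[rule_format, of w] y(2)[rule_format, of k] by (simp add: w)
  qed
  then show thesis
    by (rule that[OF P(1) y(2)[rule_format] _ approximate_eigenvector_powers[OF y(2)[rule_format] y(3)]])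
qed

section \<open>Log-convex sequences\<close>

lemma log_convex_ratio:
  fixes a :: "nat \<Rightarrow> real"
  assumes nonneg: "\<And>j. a j \<ge> 0" and conv: "\<And>j. (a (Suc j))\<^sup>2 \<le> a (Suc (Suc j)) * a j"
    and ij: "i \<le> j"
  shows "a (Suc i) * a j \<le> a (Suc j) * a i"
  using ij
proof (induction j rule: dec_induct)
  case (step j)
  show ?case
  proof (cases "a j = 0")
    case True
    then have "a (Suc j) = 0" using conv[of j] by simp
    then show ?thesis using nonneg by simp
  next
    case False
    then have pos: "a j > 0" using nonneg[of j] by simp
    have "a j * (a (Suc i) * a (Suc j)) \<le> a i * (a (Suc j))\<^sup>2"
      using mult_right_mono[OF step.IH nonneg[of "Suc j"]]
      by (simp add: power2_eq_square mult_ac)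
    also have "\<dots> \<le> a i * (a (Suc (Suc j)) * a j)"
      by (rule mult_left_mono[OF conv nonneg])
    finally show ?thesis using pos by (simp add: mult_ac)
  qed
qed simp

lemma log_convex_upper:
  fixes a :: "nat \<Rightarrow> real"
  assumes nonneg: "\<And>j. a j \<ge> 0" and conv: "\<And>j. (a (Suc j))\<^sup>2 \<le> a (Suc (Suc j)) * a j"
    and a0: "a 0 = 1"
  shows "a 1 ^ n \<le> a n"
proof (induction n)
  case (Suc n)
  have "a 1 ^ Suc n \<le> a 1 * a n" using Suc nonneg[of 1] by (simp add: mult_left_mono)
  also have "\<dots> \<le> a (Suc n)" using log_convex_ratio[of a, OF nonneg conv, of 0 n] a0 by simp
  finally show ?case .
qed (simp add: a0)

text \<open>The index \<open>n\<close> is a convex combination of \<open>1\<close> and \<open>2n\<close> with weights \<open>n/(2n-1)\<close> and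
  \<open>(n-1)/(2n-1)\<close>.\<close>

lemma log_convex_lower:
  fixes a :: "nat \<Rightarrow> real"
  assumes nonneg: "\<And>j. a j \<ge> 0" and conv: "\<And>j. (a (Suc j))\<^sup>2 \<le> a (Suc (Suc j)) * a j"
  shows "a (Suc m) ^ (2 * m + 1) \<le> a 1 ^ Suc m * a (2 * m + 2) ^ m"
proof (cases "a (Suc m) = 0")
  case True
  then show ?thesis using nonneg by simp
next
  case False
  define x y where "x = a (Suc m)" and "y = a (Suc (Suc m))"
  have x: "x > 0" using False nonneg[of "Suc m"] by (simp add: x_def)
  have y: "y \<ge> 0" using nonneg by (simp add: y_def)
  have down: "x * x ^ j \<le> y ^ j * a (Suc (m - j))" if "j \<le> m" for j
    using that
  proof (induction j)
    case 0
    then show ?case by (simp add: x_def)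
  next
    case (Suc j)
    have i: "Suc (m - j) = Suc (Suc (m - Suc j))" using Suc.prems by simp
    have "x * x ^ Suc j \<le> y ^ j * (a (Suc (m - j)) * x)"
      using mult_right_mono[OF Suc.IH, of x] Suc.prems x by (simp add: mult_ac)
    also have "\<dots> \<le> y ^ j * (y * a (Suc (m - Suc j)))"
    proof (rule mult_left_mono)
      show "a (Suc (m - j)) * x \<le> y * a (Suc (m - Suc j))"
        using log_convex_ratio[of a, OF nonneg conv, of "Suc (m - Suc j)" "Suc m"]
        unfolding i x_def y_def by simp
    qed (use y in simp)
    finally show ?case by (simp add: mult_ac)
  qed
  have up: "y ^ j * x \<le> a (Suc m + j) * x ^ j" for j
  proof (induction j)
    case 0
    then show ?case by (simp add: x_def)
  next
    case (Suc j)
    have "y ^ Suc j * x \<le> (y * a (Suc m + j)) * x ^ j"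
      using mult_left_mono[OF Suc y] by (simp add: mult_ac)
    also have "\<dots> \<le> (a (Suc (Suc m + j)) * x) * x ^ j"
    proof (rule mult_right_mono)
      show "y * a (Suc m + j) \<le> a (Suc (Suc m + j)) * x"
        using log_convex_ratio[of a, OF nonneg conv, of "Suc m" "Suc m + j"]
        by (simp add: x_def y_def)
    qed (use x in simp)
    finally show ?case by (simp add: mult_ac)
  qed
  have up': "y ^ Suc m * x \<le> a (2 * m + 2) * x ^ Suc m"
    using up[of "Suc m"] by (simp add: mult_2)
  have exponent: "2 * m + 1 + Suc m * m = Suc m * Suc m + m" by simp
  have "x ^ (2 * m + 1) * x ^ (Suc m * m) = (x * x ^ m) ^ Suc m * x ^ m"
    by (simp only: power_Suc[symmetric] power_mult[symmetric] power_add[symmetric] exponent)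
  also have "\<dots> \<le> (y ^ m * a 1) ^ Suc m * x ^ m"
    using down[of m] x by (intro mult_right_mono power_mono) auto
  also have "\<dots> = a 1 ^ Suc m * (y ^ Suc m * x) ^ m"
    by (simp only: power_mult_distrib power_mult[symmetric] mult_ac)
  also have "\<dots> \<le> a 1 ^ Suc m * (a (2 * m + 2) * x ^ Suc m) ^ m"
    using up' x y nonneg[of 1] by (intro mult_left_mono power_mono) auto
  also have "\<dots> = (a 1 ^ Suc m * a (2 * m + 2) ^ m) * x ^ (Suc m * m)"
    by (simp only: power_mult_distrib power_mult[symmetric] mult_ac)
  finally show ?thesis using x by (simp add: x_def)
qed

section \<open>Paranormal roots of quasinormal operators\<close>

lemma quasinormal_iff: "quasinormal T \<longleftrightarrow> T o\<^sub>L (adj T o\<^sub>L T) = (adj T o\<^sub>L T) o\<^sub>L T"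
  by (simp add: quasinormal_def commutator_def)

lemma inner_adj_compose:
  "clinear_op T \<Longrightarrow> inner ((adj T o\<^sub>L T) x) y = inner (T x) (T y)"
  by (metis blinfun_apply_blinfun_compose inner_adj inner_commute)

text \<open>Let \<open>A = T\<^sup>*T\<close> and \<open>Q = S\<^sup>*S\<close>.  All inner products occurring in \<open>\<parallel>TQx - QTx\<parallel>\<^sup>2\<close> equal
  \<open>\<langle>AQx, Qx\<rangle>\<close>, so \<open>T\<close> commutes with \<open>Q\<close> although it need not commute with \<open>S\<^sup>*\<close>.\<close>

lemma commute_adj_compose_root:
  fixes S T :: "'a::chilbert_space \<Rightarrow>\<^sub>L 'a"
  assumes T: "clinear_op T" and S: "clinear_op S" and TS: "T o\<^sub>L S = S o\<^sub>L T"
    and SA: "S o\<^sub>L (adj T o\<^sub>L T) = (adj T o\<^sub>L T) o\<^sub>L S" and SQ: "quasinormal S"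
  shows "(adj T o\<^sub>L T) o\<^sub>L (adj S o\<^sub>L S) = (adj S o\<^sub>L S) o\<^sub>L (adj T o\<^sub>L T)"
    and "T o\<^sub>L (adj S o\<^sub>L S) = (adj S o\<^sub>L S) o\<^sub>L T"
proof -
  define A Q where "A = adj T o\<^sub>L T" and "Q = adj S o\<^sub>L S"
  have A: "inner (A x) y = inner (T x) (T y)" and Q: "inner (Q x) y = inner (S x) (S y)" for x y
    unfolding A_def Q_def by (rule inner_adj_compose[OF T] inner_adj_compose[OF S])+
  have A': "inner x (A y) = inner (T x) (T y)" and Q': "inner x (Q y) = inner (S x) (S y)" for x y
    using A[of y x] Q[of y x] by (simp_all add: inner_commute)
  have TS: "T (S x) = S (T x)" and SA: "S (A x) = A (S x)" and SQ: "S (Q x) = Q (S x)" for x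
    using TS SA SQ unfolding A_def Q_def quasinormal_iff by (simp_all add: blinfun_eq_iff)
  have AQ: "A (Q x) = Q (A x)" for x
  proof (rule vector_eq_rdot[THEN iffD1], rule allI)
    fix y
    have "inner (A (Q x)) y = inner (Q x) (A y)" by (simp add: A A')
    also have "\<dots> = inner (S x) (A (S y))" by (simp add: Q SA)
    also have "\<dots> = inner (A (S x)) (S y)" by (simp add: A A')
    also have "\<dots> = inner (Q (A x)) y" by (simp add: Q SA)
    finally show "inner (A (Q x)) y = inner (Q (A x)) y" .
  qed
  then show "(adj T o\<^sub>L T) o\<^sub>L (adj S o\<^sub>L S) = (adj S o\<^sub>L S) o\<^sub>L (adj T o\<^sub>L T)"
    unfolding A_def[symmetric] Q_def[symmetric] by (intro blinfun_eqI) simp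
  have "T (Q x) = Q (T x)" for x
  proof -
    have 1: "inner (Q (T x)) (Q (T x)) = inner (A (Q x)) (Q x)"
    proof -
      have "inner (Q (T x)) (Q (T x)) = inner (S (Q (T x))) (S (T x))" by (rule Q')
      also have "S (Q (T x)) = Q (S (T x))" by (rule SQ)
      also have "inner (Q (S (T x))) (S (T x)) = inner (S (S (T x))) (S (S (T x)))" by (rule Q)
      also have "S (S (T x)) = T (S (S x))" by (simp add: TS)
      also have "inner (T (S (S x))) (T (S (S x))) = inner (A (S (S x))) (S (S x))" by (simp only: A)
      also have "\<dots> = inner (S (A (S x))) (S (S x))" by (simp only: SA)
      also have "\<dots> = inner (A (S x)) (Q (S x))" by (simp only: Q')
      also have "\<dots> = inner (S (A x)) (S (Q x))" by (simp only: SA SQ)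
      also have "\<dots> = inner (Q (A x)) (Q x)" by (simp only: Q)
      finally show ?thesis by (simp only: AQ)
    qed
    have 2: "inner (Q (T x)) (T (Q x)) = inner (A (Q x)) (Q x)"
    proof -
      have "inner (Q (T x)) (T (Q x)) = inner (S (T x)) (S (T (Q x)))" by (rule Q)
      also have "\<dots> = inner (A (S x)) (S (Q x))" by (simp only: TS[symmetric] A)
      also have "\<dots> = inner (S (A x)) (S (Q x))" by (simp only: SA)
      also have "\<dots> = inner (Q (A x)) (Q x)" by (simp only: Q)
      finally show ?thesis by (simp only: AQ)
    qed
    have 3: "inner (T (Q x)) (T (Q x)) = inner (A (Q x)) (Q x)" by (simp only: A)
    have "inner (T (Q x) - Q (T x)) (T (Q x) - Q (T x)) = 0"
      using 1 2 3 by (simp add: inner_diff_left inner_diff_right inner_commute)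
    then show ?thesis by simp
  qed
  then show "T o\<^sub>L (adj S o\<^sub>L S) = (adj S o\<^sub>L S) o\<^sub>L T"
    unfolding Q_def[symmetric] by (intro blinfun_eqI) simp
qed

text \<open>Let \<open>S = T\<^sup>n\<close>, \<open>A = T\<^sup>*T\<close>, \<open>Q = S\<^sup>*S\<close> and \<open>B = Q\<^sup>1\<^sup>/\<^sup>n\<close>.  Since \<open>T\<close> commutes with \<open>Q\<close>, hence with
  \<open>B\<close>, it suffices to show \<open>A = B\<close>.  For a unit vector \<open>x\<close> the sequence \<open>\<parallel>T\<^sup>jx\<parallel>\<close> is log-convex, and its
  squares at the indices \<open>1\<close>, \<open>n\<close> and \<open>2n\<close> are \<open>\<langle>Ax, x\<rangle>\<close>, \<open>\<langle>B\<^sup>nx, x\<rangle>\<close> and \<open>\<langle>B\<^sup>2\<^sup>nx, x\<rangle>\<close>.  Comparing these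
  on approximate eigenvectors of \<open>B\<close> excludes \<open>A \<ge> B + e\<close> and \<open>A \<le> B - e\<close> there.\<close>

lemma paranormal_imp_quasinormal:
  fixes T :: "'a::chilbert_space \<Rightarrow>\<^sub>L 'a"
  assumes T: "clinear_op T" and n: "n \<ge> 1"
    and comm: "op_power T n o\<^sub>L (adj T o\<^sub>L T) = (adj T o\<^sub>L T) o\<^sub>L op_power T n"
    and qn: "quasinormal (op_power T n)"
    and para: "\<And>x. (norm (T x))\<^sup>2 \<le> norm (T (T x)) * norm x"
  shows "quasinormal T"
proof -
  define S where "S = op_power T n"
  define A Q where "A = adj T o\<^sub>L T" and "Q = adj S o\<^sub>L S"
  define B where "B = op_powr Q (1 / n)"
  have S: "clinear_op S" unfolding S_def by (rule clinear_op_power[OF T])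
  have A: "positive_op A" and Q: "positive_op Q"
    unfolding A_def Q_def by (rule positive_adj_compose[OF T] positive_adj_compose[OF S])+
  have B: "positive_op B" unfolding B_def by (rule positive_op_powr[OF Q]) simp
  have TS: "T o\<^sub>L S = S o\<^sub>L T" unfolding S_def by (rule op_power_commute) simp
  have AQ: "A o\<^sub>L Q = Q o\<^sub>L A" and TQ: "T o\<^sub>L Q = Q o\<^sub>L T"
    unfolding A_def Q_def
    by (rule commute_adj_compose_root[OF T S TS comm[folded S_def] qn[folded S_def]])+
  have AB: "A o\<^sub>L B = B o\<^sub>L A" and TB: "T o\<^sub>L B = B o\<^sub>L T"
    unfolding B_def using op_powr_commute[OF Q _ AQ] op_powr_commute[OF Q _ TQ] by simp_all
  have Bn: "op_power B n = Q"
    unfolding B_def using n by (simp add: op_power_op_powr[OF Q] op_powr_1[OF Q])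
  have QS: "Q (S x) = S (Q x)" for x
    using qn[folded S_def] unfolding quasinormal_iff Q_def by (simp add: blinfun_eq_iff)
  have nT: "inner (A x) x = (norm (T x))\<^sup>2" for x
    unfolding A_def inner_adj_compose[OF T] by (simp add: power2_norm_eq_inner)
  have nS: "inner (Q x) x = (norm (S x))\<^sup>2" for x
    unfolding Q_def inner_adj_compose[OF S] by (simp add: power2_norm_eq_inner)
  have nSS: "inner (Q (Q x)) x = (norm (S (S x)))\<^sup>2" for x
  proof -
    have "inner (Q (Q x)) x = inner (S (Q x)) (S x)"
      unfolding Q_def by (rule inner_adj_compose[OF S])
    also have "\<dots> = (norm (S (S x)))\<^sup>2" by (simp only: QS[symmetric] nS)
    finally show ?thesis .
  qed
  define a where "a x j = norm (op_power T j x)" for x j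
  have a: "a x j \<ge> 0" "(a x (Suc j))\<^sup>2 \<le> a x (Suc (Suc j)) * a x j" for x j
    unfolding a_def using para[of "op_power T j x"] by simp_all
  obtain m where m: "n = Suc m" using n by (cases n) auto
  have a1: "(a x 1)\<^sup>2 = inner (A x) x" and an: "(a x n)\<^sup>2 = inner (Q x) x"
    and a2n: "(a x (2 * m + 2))\<^sup>2 = inner (Q (Q x)) x" for x
  proof -
    show "(a x 1)\<^sup>2 = inner (A x) x" "(a x n)\<^sup>2 = inner (Q x) x"
      by (simp_all add: a_def nT nS S_def)
    have "2 * m + 2 = n + n" by (simp add: m)
    then show "(a x (2 * m + 2))\<^sup>2 = inner (Q (Q x)) x"
      by (simp only: a_def op_power_add nSS S_def blinfun_apply_blinfun_compose)
  qed
  have upper: "inner (A x) x ^ n \<le> inner (Q x) x" if "norm x = 1" for x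
  proof -
    have "a x 1 ^ n \<le> a x n" by (rule log_convex_upper) (use a that in \<open>auto simp: a_def\<close>)
    then have "(a x 1 ^ n)\<^sup>2 \<le> (a x n)\<^sup>2" by (rule power_mono) (use a in simp)
    then show ?thesis by (simp only: power_mult[symmetric] mult.commute[of n] power_mult a1 an)
  qed
  have lower: "inner (Q x) x ^ (2 * m + 1) \<le> inner (A x) x ^ n * inner (Q (Q x)) x ^ m" for x
  proof -
    have "a x n ^ (2 * m + 1) \<le> a x 1 ^ n * a x (2 * m + 2) ^ m"
      unfolding m by (rule log_convex_lower) (use a in auto)
    then have "(a x n ^ (2 * m + 1))\<^sup>2 \<le> (a x 1 ^ n * a x (2 * m + 2) ^ m)\<^sup>2"
      by (rule power_mono) (use a in simp)
    then show ?thesis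
      by (simp only: power_mult_distrib power_mult[symmetric] mult.commute[of _ 2])
        (simp only: power_mult a1 an a2n)
  qed
  have saB: "self_adjoint B" and saA: "self_adjoint A" using A B by (auto simp: positive_op_def)
  have B_ge: "0 \<le> inner (B x) x" and A_ge: "0 \<le> inner (A x) x" for x
    using A B by (auto simp: positive_op_def)
  have limQ: "(\<lambda>k. inner (Q (y k)) (y k)) \<longlonglongrightarrow> s ^ n"
    and limQQ: "(\<lambda>k. inner (Q (Q (y k))) (y k)) \<longlonglongrightarrow> s ^ n * s ^ n"
    and limB: "(\<lambda>k. inner (B (y k)) (y k)) \<longlonglongrightarrow> s"
    if lim: "\<And>j. (\<lambda>k. inner (op_power B j (y k)) (y k)) \<longlonglongrightarrow> s ^ j" for s and y :: "nat \<Rightarrow> 'a"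
    using lim[of n] lim[of "n + n"] lim[of 1] by (simp_all add: Bn op_power_add power_add)
  \<comment> \<open>With \<open>s\<close> the approximate eigenvalue of \<open>B\<close>, the bound \<open>upper\<close> tends to \<open>(s + e)\<^sup>n \<le> s\<^sup>n\<close>.\<close>
  have le1: "inner ((A - B) x) x \<le> 0" for x
  proof (rule ccontr)
    assume "\<not> inner ((A - B) x) x \<le> 0"
    then have pos: "inner ((A - B) x) x > 0" by simp
    have "B o\<^sub>L (A - B) = (A - B) o\<^sub>L B" using AB by (simp add: blinfun_eq_iff blinfun.bilinear_simps)
    from joint_approximate_eigenvector[OF self_adjoint_diff[OF saA saB] saB this pos]
    obtain e s y where y: "e > 0" "\<forall>k::nat. norm (y k) = 1" "\<forall>k. e \<le> inner ((A - B) (y k)) (y k)"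
      "\<forall>j. (\<lambda>k. inner (op_power B j (y k)) (y k)) \<longlonglongrightarrow> s ^ j" by metis
    note lim = limQ[OF y(4)[rule_format]] limB[OF y(4)[rule_format]]
    have "(\<lambda>k. (inner (B (y k)) (y k) + e) ^ n) \<longlonglongrightarrow> (s + e) ^ n"
      by (intro tendsto_intros lim)
    then have "(s + e) ^ n \<le> s ^ n"
    proof (rule LIMSEQ_le[OF _ lim(1)], intro exI allI impI)
      fix k
      have "inner (B (y k)) (y k) + e \<le> inner (A (y k)) (y k)"
        using y(3)[rule_format, of k] by (simp add: blinfun.bilinear_simps inner_diff_left)
      then have "(inner (B (y k)) (y k) + e) ^ n \<le> inner (A (y k)) (y k) ^ n"
        using B_ge[of "y k"] y(1) by (intro power_mono) auto
      also have "\<dots> \<le> inner (Q (y k)) (y k)" using upper y(2) by blast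
      finally show "(inner (B (y k)) (y k) + e) ^ n \<le> inner (Q (y k)) (y k)" .
    qed
    moreover have "s \<ge> 0" by (rule LIMSEQ_le_const[OF lim(2)]) (use B_ge in blast)
    then have "s ^ n < (s + e) ^ n" using y(1) n by (intro power_strict_mono) auto
    ultimately show False by simp
  qed
  \<comment> \<open>Here the bound \<open>lower\<close> tends to \<open>s\<^sup>n\<^sup>(\<^sup>2\<^sup>n\<^sup>-\<^sup>1\<^sup>) \<le> (s - e)\<^sup>n s\<^sup>2\<^sup>n\<^sup>(\<^sup>n\<^sup>-\<^sup>1\<^sup>)\<close>, where \<open>n = m + 1\<close>.\<close>
  have le2: "inner ((B - A) x) x \<le> 0" for x
  proof (rule ccontr)
    assume "\<not> inner ((B - A) x) x \<le> 0"
    then have pos: "inner ((B - A) x) x > 0" by simp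
    have "B o\<^sub>L (B - A) = (B - A) o\<^sub>L B" using AB by (simp add: blinfun_eq_iff blinfun.bilinear_simps)
    from joint_approximate_eigenvector[OF self_adjoint_diff[OF saB saA] saB this pos]
    obtain e s y where y: "e > 0" "\<forall>k::nat. norm (y k) = 1" "\<forall>k. e \<le> inner ((B - A) (y k)) (y k)"
      "\<forall>j. (\<lambda>k. inner (op_power B j (y k)) (y k)) \<longlonglongrightarrow> s ^ j" by metis
    note lim = limQ[OF y(4)[rule_format]] limB[OF y(4)[rule_format]] limQQ[OF y(4)[rule_format]]
    have A_le: "inner (A (y k)) (y k) \<le> inner (B (y k)) (y k) - e" for k
      using y(3)[rule_format, of k] by (simp add: blinfun.bilinear_simps inner_diff_left)
    have "e \<le> s"
    proof (rule LIMSEQ_le_const[OF lim(2)], intro exI allI impI)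
      fix k show "e \<le> inner (B (y k)) (y k)" using A_le[of k] A_ge[of "y k"] by simp
    qed
    have le: "(s ^ n) ^ (2 * m + 1) \<le> (s - e) ^ n * (s ^ n * s ^ n) ^ m"
    proof (rule LIMSEQ_le)
      show "(\<lambda>k. inner (Q (y k)) (y k) ^ (2 * m + 1)) \<longlonglongrightarrow> (s ^ n) ^ (2 * m + 1)"
        by (intro tendsto_intros lim)
      show "(\<lambda>k. (inner (B (y k)) (y k) - e) ^ n * inner (Q (Q (y k))) (y k) ^ m)
          \<longlonglongrightarrow> (s - e) ^ n * (s ^ n * s ^ n) ^ m"
        by (intro tendsto_intros lim)
      show "\<exists>N. \<forall>k\<ge>N. inner (Q (y k)) (y k) ^ (2 * m + 1)
          \<le> (inner (B (y k)) (y k) - e) ^ n * inner (Q (Q (y k))) (y k) ^ m"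
      proof (intro exI allI impI)
        fix k
        have "inner (A (y k)) (y k) ^ n * inner (Q (Q (y k))) (y k) ^ m
            \<le> (inner (B (y k)) (y k) - e) ^ n * inner (Q (Q (y k))) (y k) ^ m"
          using A_le A_ge by (intro mult_right_mono power_mono) (auto simp: nSS)
        then show "inner (Q (y k)) (y k) ^ (2 * m + 1)
            \<le> (inner (B (y k)) (y k) - e) ^ n * inner (Q (Q (y k))) (y k) ^ m"
          using lower[of "y k"] by linarith
      qed
    qed
    have split: "(s ^ n) ^ (2 * m + 1) = s ^ n * (s ^ n * s ^ n) ^ m"
      by (simp add: power_mult power2_eq_square)
    have "(s ^ n * s ^ n) ^ m > 0" using \<open>e \<le> s\<close> y(1) by simp
    then have "s ^ n \<le> (s - e) ^ n" by (rule mult_right_le_imp_le[OF le[unfolded split]])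
    moreover have "(s - e) ^ n < s ^ n"
      using y(1) n \<open>e \<le> s\<close> by (intro power_strict_mono) auto
    ultimately show False by simp
  qed
  have "inner ((A - B) x) x = 0" for x
    using le1[of x] le2[of x] by (simp add: blinfun.diff_left inner_diff_left)
  then have "A - B = 0" by (rule self_adjoint_eq_0[OF self_adjoint_diff[OF saA saB]])
  then have "A = B" by simp
  then show ?thesis using TB unfolding quasinormal_iff A_def by simp
qed

section \<open>Inequalities for quasinormal operators\<close>

lemma positive_op_kernel:
  fixes R :: "'a::chilbert_space \<Rightarrow>\<^sub>L 'a"
  assumes R: "positive_op R" and y: "inner (R y) y = 0"
  shows "R y = 0"
proof -
  define H where "H = op_powr R (1 / 2)"
  have H: "self_adjoint H"
    using positive_op_powr[OF R, of "1 / 2"] by (simp add: H_def positive_op_def)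
  have HH: "H (H y) = R y"
    using op_powr_add[OF R, of "1 / 2" "1 / 2"]
    by (simp add: H_def op_powr_1[OF R] blinfun_eq_iff)
  have "inner (H y) (H y) = 0" using y by (simp add: HH self_adjointD[OF H, symmetric])
  then show ?thesis using HH by (simp add: blinfun.zero_right)
qed

text \<open>For \<open>y = (R - A)x\<close> one has \<open>(R + A)y = 0\<close>, which forces \<open>Ry = Ay = 0\<close> and then
  \<open>\<parallel>y\<parallel>\<^sup>2 = \<langle>x, (R - A)y\<rangle> = 0\<close>.\<close>

lemma positive_square_root_unique:
  fixes R A :: "'a::chilbert_space \<Rightarrow>\<^sub>L 'a"
  assumes R: "positive_op R" and A: "positive_op A" and RA: "R o\<^sub>L A = A o\<^sub>L R"
    and eq: "R o\<^sub>L R = A o\<^sub>L A"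
  shows "R = A"
proof (rule blinfun_eqI)
  fix x
  define y where "y = R x - A x"
  have comm: "R (A z) = A (R z)" and sq: "R (R z) = A (A z)" for z
    using RA eq by (simp_all add: blinfun_eq_iff)
  have "R y + A y = 0" by (simp add: y_def blinfun.bilinear_simps comm sq)
  then have "inner (R y) y + inner (A y) y = 0" by (metis inner_add_left inner_zero_left)
  moreover have "inner (R y) y \<ge> 0" "inner (A y) y \<ge> 0" using R A by (auto simp: positive_op_def)
  ultimately have "R y = 0" "A y = 0" by (intro positive_op_kernel R A; linarith)+
  moreover have "inner y y = inner x (R y) - inner x (A y)"
    using R A by (simp add: y_def[of] inner_diff_left positive_op_def self_adjointD)
  ultimately have "y = 0" by simp
  then show "R x = A x" by (simp add: y_def)
qed

lemma op_power_2: "op_power T 2 = T o\<^sub>L T"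
  by (rule blinfun_eqI) (simp add: numeral_2_eq_2)

lemma op_le_imp_inner_le: "op_le A B \<Longrightarrow> inner (A x) x \<le> inner (B x) x"
  by (auto simp: op_le_def inner_eq_Re_cinner[symmetric] blinfun.diff_left inner_diff_left
      complex_nonneg_Reals_iff dest: spec[of _ x])

lemma op_le_refl: "op_le A A"
proof -
  have "cinner 0 x = 0" for x :: 'a
    using cinner_add_left[of 0 0 x] by simp
  then show ?thesis by (simp add: op_le_def)
qed

lemma class_A_imp_paranormal:
  assumes T: "clinear_op T" and le: "op_le (op_power (op_abs T) 2) (op_abs (op_power T 2))"
  shows "(norm (T x))\<^sup>2 \<le> norm (op_power T 2 x) * norm x"
proof -
  have T2: "clinear_op (op_power T 2)" by (rule clinear_op_power[OF T])
  have "(norm (T x))\<^sup>2 = inner (op_power (op_abs T) 2 x) x"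
    by (simp only: op_power_2 op_abs_square[OF T] inner_adj_compose[OF T] power2_norm_eq_inner)
  also have "\<dots> \<le> inner (op_abs (op_power T 2) x) x" by (rule op_le_imp_inner_le[OF le])
  also have "\<dots> \<le> norm (op_abs (op_power T 2) x) * norm x" by (rule norm_cauchy_schwarz)
  finally show ?thesis by (simp only: norm_op_abs[OF T2])
qed

lemma quasinormal_imp_op_abs_square:
  assumes T: "clinear_op T" and q: "quasinormal T"
  shows "op_abs (op_power T 2) = op_power (op_abs T) 2"
proof -
  define A where "A = adj T o\<^sub>L T"
  define S where "S = op_power T 2"
  define Q where "Q = adj S o\<^sub>L S"
  have A: "positive_op A" unfolding A_def by (rule positive_adj_compose[OF T])
  have S: "clinear_op S" unfolding S_def by (rule clinear_op_power[OF T])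
  have TA: "T (A x) = A (T x)" for x
    using q unfolding quasinormal_iff A_def by (simp add: blinfun_eq_iff)
  have Q: "Q = A o\<^sub>L A"
  proof (rule blinfun_eqI, rule vector_eq_rdot[THEN iffD1], rule allI)
    fix x y
    have "inner (Q x) y = inner (T (T x)) (T (T y))"
      unfolding Q_def inner_adj_compose[OF S] by (simp add: S_def op_power_2)
    also have "\<dots> = inner (A (T x)) (T y)" by (simp only: A_def inner_adj_compose[OF T])
    also have "\<dots> = inner (T (A x)) (T y)" by (simp only: TA)
    also have "\<dots> = inner (A (A x)) y" by (simp only: A_def inner_adj_compose[OF T])
    finally show "inner (Q x) y = inner ((A o\<^sub>L A) x) y" by simp
  qed
  have "op_abs S = A"
  proof (rule positive_square_root_unique[OF positive_op_abs[OF S] A])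
    show "op_abs S o\<^sub>L op_abs S = A o\<^sub>L A" using Q op_abs_square[OF S] by (simp add: Q_def)
    have "A o\<^sub>L op_abs S = op_abs S o\<^sub>L A"
      by (rule op_abs_commute[OF S]) (simp add: Q[unfolded Q_def] blinfun_eq_iff)
    then show "op_abs S o\<^sub>L A = A o\<^sub>L op_abs S" by simp
  qed
  then show ?thesis by (simp only: S_def A_def op_power_2 op_abs_square[OF T])
qed

text \<open>The norm occurring in both inequalities is zero, which turns them into paranormality of \<open>T\<close> and
  into \<open>|T|\<^sup>2 \<le> |T\<^sup>2|\<close>.\<close>

theorem corollary4p7:
  fixes T :: "'a::chilbert_space \<Rightarrow>\<^sub>L 'a" and l :: real and n :: nat
  assumes "clinear_op T"
    and "0 < l" and "l \<le> 1"
    and "n \<ge> 2"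
    and "power_quasinormal n T"
    and "quasinormal (op_power T n)"
  shows
    "(quasinormal T \<longleftrightarrow>
        (\<forall>x. (norm (T x))\<^sup>2 \<le> norm (op_power T 2 x) * norm x
          + norm (op_power (aluthge l T) n - aluthge l (op_power T n)) * (norm x)\<^sup>2))
     \<and> (quasinormal T \<longleftrightarrow>
        op_le (op_power (op_abs T) 2)
          (op_abs (op_power T 2)
            + norm (op_power (aluthge l T) n - aluthge l (op_power T n)) *\<^sub>R id_blinfun))"
proof -
  note T = assms(1) and l = assms(2,3)
  have n: "n \<ge> 1" using assms(4) by simp
  have comm: "op_power T n o\<^sub>L (adj T o\<^sub>L T) = (adj T o\<^sub>L T) o\<^sub>L op_power T n"
    using assms(5) by (simp add: power_quasinormal_def commutator_def)
  have "op_power (aluthge l T) n = aluthge l (op_power T n)"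
    using aluthge_power[OF T l n comm] aluthge_quasinormal[OF clinear_op_power[OF T] l assms(6)]
    by simp
  then have D: "norm (op_power (aluthge l T) n - aluthge l (op_power T n)) = 0" by simp
  have iii: "op_le (op_power (op_abs T) 2) (op_abs (op_power T 2))" if "quasinormal T"
    using quasinormal_imp_op_abs_square[OF T that] by (simp add: op_le_refl)
  have i: "quasinormal T" if "\<forall>x. (norm (T x))\<^sup>2 \<le> norm (op_power T 2 x) * norm x"
    by (rule paranormal_imp_quasinormal[OF T n comm assms(6)]) (use that in \<open>simp add: op_power_2\<close>)
  show ?thesis
    unfolding D using i iii class_A_imp_paranormal[OF T] by auto
qed

end
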